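(* Suppose the competing prices are uniformly distributed on $[0,1]$, and $k(t)=1-\frac{1}{1+t}$ for $t\ge0$. Let $\mu>0$ and let $\alpha\in(0,1]$ satisfy $\mu\alpha>1$. For $\gamma>0$ let $V_0^{\alpha}=V_{\alpha k,\gamma,\mu}(0)$ be the expected discounted payoff, starting from age $0$, of the shading policy $b(\tau)=\alpha k(\tau)$. Then $$\lim_{\gamma\to0}\gamma V_0^{\alpha}=\left(1-\frac{\alpha}{2}\right)(\mu\alpha)^2\,\frac{\Gamma(\mu\alpha-1,\mu\alpha)}{\Gamma(\mu\alpha+1,\mu\alpha)},$$ where $\Gamma(s,x)=\int_x^{\infty}t^{s-1}e^{-t}\,dt$ is the upper incomplete gamma function.
   Context: Setting. Auctions arrive according to a Poisson process of intensity $\mu>0$. At the $i$-th auction the highest competing price is $C_i\ge 0$; the $C_i$ are i.i.d. and independent of the arrivals. The age $\tau$ is the time elapsed since the last won auction: it grows at unit rate and is reset to $0$ after each win. An item won at age $\tau$ has value $k(\tau)$ for the bidder. A bidding policy is a measurable function $b:[0,\infty)\to[0,\infty)$, where $b(\tau)$ is the bid submitted when the age is $\tau$. An auction is won iff the bid is $>C_i$, and the winner pays $C_i$ (second price). With discount rate $\gamma>0$, current age $\tau$, next auctions occurring at times $T_1<T_2<\dots$ (measured from now), and $\tau(T_i)$ the age just before the auction at time $T_i$ under policy $b$, set $$V_{b,\gamma,\mu}(\tau)=\mathbb{E}\sum_{i\ge1}e^{-\gamma T_i}\left(k(\tau(T_i))-C_i\right)\mathbf{1}\{b(\tau(T_i))>C_i\}.$$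 *)

theory Defs
  imports "HOL-Probability.Probability"
begin

text \<open>Sequences are indexed from \<open>0\<close>: \<open>T 0 < T 1 < ...\<close> are the auction times, and \<open>C i\<close> is the
  highest competing price at the auction held at time \<open>T i\<close>.\<close>

definition interarrival :: "(nat \<Rightarrow> 'a \<Rightarrow> real) \<Rightarrow> nat \<Rightarrow> 'a \<Rightarrow> real" where
  "interarrival T i \<omega> = (case i of 0 \<Rightarrow> T 0 \<omega> | Suc j \<Rightarrow> T (Suc j) \<omega> - T j \<omega>)"

text \<open>A Poisson process of intensity \<open>\<mu>\<close> is given by its arrival times \<open>T\<close>: the waiting
  times between consecutive arrivals are i.i.d. exponential with parameter \<open>\<mu>\<close>. The common law of
  the competing prices is \<open>P\<close>. Independence of prices and arrivals is independence of the two
  whole sequences.\<close>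

locale auction_model = prob_space M
  for M :: "'a measure" +
  fixes \<mu> :: real
    and T :: "nat \<Rightarrow> 'a \<Rightarrow> real"
    and P :: "real measure"
    and C :: "nat \<Rightarrow> 'a \<Rightarrow> real"
  assumes intensity_pos: "0 < \<mu>"
    and interarrival_indep: "indep_vars (\<lambda>_. borel) (interarrival T) UNIV"
    and interarrival_exponential:
      "\<And>i. distributed M lborel (interarrival T i) (exponential_density \<mu>)"
    and price_indep: "indep_vars (\<lambda>_. borel) C UNIV"
    and price_law: "\<And>i. distr M borel (C i) = P"
    and price_nonneg: "AE c in P. 0 \<le> c"
    and arrivals_prices_indep:
      "indep_var (\<Pi>\<^sub>M i\<in>UNIV. borel) (\<lambda>\<omega> i. T i \<omega>) (\<Pi>\<^sub>M i\<in>UNIV. borel) (\<lambda>\<omega> i. C i \<omega>)"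

text \<open>\<open>age b \<tau> t c i\<close> is the age just before the auction at time \<open>t i\<close>, when the age at time \<open>0\<close>
  is \<open>\<tau>\<close>, the bidder follows the policy \<open>b\<close>, and the competing prices are \<open>c\<close>.\<close>

primrec age :: "(real \<Rightarrow> real) \<Rightarrow> real \<Rightarrow> (nat \<Rightarrow> real) \<Rightarrow> (nat \<Rightarrow> real) \<Rightarrow> nat \<Rightarrow> real" where
  "age b \<tau> t c 0 = \<tau> + t 0"
| "age b \<tau> t c (Suc i) =
     (if b (age b \<tau> t c i) > c i then 0 else age b \<tau> t c i) + (t (Suc i) - t i)"

definition discounted_payoff ::
  "(real \<Rightarrow> real) \<Rightarrow> (real \<Rightarrow> real) \<Rightarrow> real \<Rightarrow> real \<Rightarrow> (nat \<Rightarrow> real) \<Rightarrow> (nat \<Rightarrow> real) \<Rightarrow> real" where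
  "discounted_payoff k b \<gamma> \<tau> t c =
     (\<Sum>i. exp (- \<gamma> * t i) * (k (age b \<tau> t c i) - c i) * of_bool (b (age b \<tau> t c i) > c i))"

definition policy_value ::
  "'a measure \<Rightarrow> (nat \<Rightarrow> 'a \<Rightarrow> real) \<Rightarrow> (nat \<Rightarrow> 'a \<Rightarrow> real) \<Rightarrow>
    (real \<Rightarrow> real) \<Rightarrow> (real \<Rightarrow> real) \<Rightarrow> real \<Rightarrow> real \<Rightarrow> real" where
  "policy_value M T C k b \<gamma> \<tau> =
     (\<integral>\<omega>. discounted_payoff k b \<gamma> \<tau> (\<lambda>i. T i \<omega>) (\<lambda>i. C i \<omega>) \<partial>M)"

definition upper_Gamma :: "real \<Rightarrow> real \<Rightarrow> real" where
  "upper_Gamma s x = (LBINT t:{x..}. t powr (s - 1) * exp (- t))"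

end

theory Submission
  imports Defs "HOL-Real_Asymp.Real_Asymp"
begin

text \<open>With \<open>a = \<mu> \<alpha>\<close>, the shading policy wins at rate \<open>a k(\<tau>)\<close> at age \<open>\<tau>\<close>, and the expected payoff of an
  auction held at age \<open>\<tau>\<close> is \<open>\<alpha> (1 - \<alpha>/2) k(\<tau>)\<^sup>2\<close>. The value function is therefore the
  bounded solution of the linear equation \<open>h' = (\<gamma> + a k) h - \<mu> \<alpha> (1 - \<alpha>/2) k\<^sup>2 - a k h(0)\<close>, which is explicit in terms
  of the discounted survival function \<open>W(u) = e\<^bsup>-(\<gamma> + a) u\<^esup> (1 + u)\<^bsup>a\<^esup>\<close> of the time between two
  wins. At \<open>0\<close> it satisfies \<open>\<gamma> h(0) = (1 - \<alpha>/2) (\<integral> a k\<^sup>2 W) / (\<integral> W)\<close>. That \<open>h\<close> is indeed the policy value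
  follows because it makes the expected discounted payoffs telescope. As \<open>\<gamma>\<close> tends to \<open>0\<close>, the
  integrals converge by dominated convergence; since \<open>(k W)' = W / (1 + u)\<^sup>2 - a k\<^sup>2 W\<close> for \<open>\<gamma> = 0\<close>, the
  numerator becomes \<open>\<integral> W / (1 + u)\<^sup>2\<close>, and both limits are incomplete gamma integrals.\<close>

section \<open>Independence and iterated expectations\<close>

context prob_space
begin

lemma indep_vars_prob_Ball:
  assumes "indep_vars N X I" "finite J" "J \<subseteq> I" "\<And>j. j \<in> J \<Longrightarrow> A j \<in> sets (N j)"
  shows "prob {\<omega> \<in> space M. \<forall>j\<in>J. X j \<omega> \<in> A j} = (\<Prod>j\<in>J. prob (X j -` A j \<inter> space M))"
proof (cases "J = {}")
  case True
  then show ?thesis by (simp add: prob_space)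
next
  case False
  have "{\<omega> \<in> space M. \<forall>j\<in>J. X j \<omega> \<in> A j} = (\<Inter>j\<in>J. X j -` A j \<inter> space M)"
    using False by auto
  with indep_varsD[OF assms(1) False assms(2,3,4)]
  show ?thesis by simp
qed

text \<open>A finite intersection of events splits into a cylinder in the \<open>X\<close>
  coordinates and one in the \<open>Y\<close> coordinates. Independence of the two sequences factors
  these two, and independence inside each family factors the rest. With the sum type as index set,
  blocks mixing both families can later be separated by restriction to disjoint index sets.\<close>

lemma indep_vars_case_sum:
  fixes X Y :: "'i \<Rightarrow> 'a \<Rightarrow> real"
  assumes X: "indep_vars (\<lambda>_. borel) X UNIV" and Y: "indep_vars (\<lambda>_. borel) Y UNIV"
    and XY: "indep_var (\<Pi>\<^sub>M i\<in>UNIV. borel) (\<lambda>\<omega> i. X i \<omega>) (\<Pi>\<^sub>M i\<in>UNIV. borel) (\<lambda>\<omega> i. Y i \<omega>)"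
  shows "indep_vars (\<lambda>_. borel) (case_sum X Y) UNIV"
  unfolding indep_vars_def2
proof (intro conjI ballI indep_setsI)
  have mX [measurable]: "X i \<in> borel_measurable M" for i
    using X unfolding indep_vars_def by auto
  have mY [measurable]: "Y i \<in> borel_measurable M" for i
    using Y unfolding indep_vars_def by auto
  show m: "case_sum X Y i \<in> borel_measurable M" for i
    by (cases i) auto
  show "{case_sum X Y i -` A \<inter> space M |A. A \<in> sets borel} \<subseteq> events" for i
    using m[of i] by (auto simp: measurable_def)
  fix B J
  assume J: "J \<noteq> {}" "finite J"
    and "\<forall>j\<in>J. B j \<in> {case_sum X Y j -` A \<inter> space M |A. A \<in> sets borel}"
  then have "\<forall>j\<in>J. \<exists>A. A \<in> sets borel \<and> B j = case_sum X Y j -` A \<inter> space M"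
    by blast
  then obtain A where A: "\<And>j. j \<in> J \<Longrightarrow> A j \<in> sets borel"
    and B: "\<And>j. j \<in> J \<Longrightarrow> B j = case_sum X Y j -` A j \<inter> space M"
    by metis
  define J1 where "J1 = Inl -` J"
  define J2 where "J2 = Inr -` J"
  have J12: "J = Inl ` J1 \<union> Inr ` J2"
  proof (rule set_eqI)
    show "x \<in> J \<longleftrightarrow> x \<in> Inl ` J1 \<union> Inr ` J2" for x
      by (cases x) (auto simp: J1_def J2_def)
  qed
  have fin: "finite J1" "finite J2"
    using J(2) unfolding J1_def J2_def by (auto intro: finite_vimageI)
  have A1: "A (Inl j) \<in> sets borel" if "j \<in> J1" for j
    using A that J1_def by auto
  have A2: "A (Inr j) \<in> sets borel" if "j \<in> J2" for j
    using A that J2_def by auto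
  define XA :: "('i \<Rightarrow> real) set"
    where "XA = {x \<in> space (\<Pi>\<^sub>M i\<in>UNIV. borel). \<forall>j\<in>J1. x j \<in> A (Inl j)}"
  define YA :: "('i \<Rightarrow> real) set"
    where "YA = {x \<in> space (\<Pi>\<^sub>M i\<in>UNIV. borel). \<forall>j\<in>J2. x j \<in> A (Inr j)}"
  have XA: "XA \<in> sets (\<Pi>\<^sub>M i\<in>UNIV. borel)"
    unfolding XA_def
    by (intro sets.sets_Collect_finite_All fin measurable_sets_Collect[OF measurable_component_singleton]) (auto simp: A1)
  have YA: "YA \<in> sets (\<Pi>\<^sub>M i\<in>UNIV. borel)"
    unfolding YA_def
    by (intro sets.sets_Collect_finite_All fin measurable_sets_Collect[OF measurable_component_singleton]) (auto simp: A2)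
  have "(\<Inter>j\<in>J. B j) = (\<Inter>j\<in>J. case_sum X Y j -` A j \<inter> space M)"
    using B by simp
  also have "\<dots> = (\<lambda>\<omega>. (\<lambda>i. X i \<omega>, \<lambda>i. Y i \<omega>)) -` (XA \<times> YA) \<inter> space M"
    using J(1) by (auto simp: J12 XA_def YA_def space_PiM ball_Un)
  finally have "prob (\<Inter>j\<in>J. B j) =
      prob ((\<lambda>\<omega> i. X i \<omega>) -` XA \<inter> space M) * prob ((\<lambda>\<omega> i. Y i \<omega>) -` YA \<inter> space M)"
    using indep_varD[OF XY XA YA] by simp
  also have "(\<lambda>\<omega> i. X i \<omega>) -` XA \<inter> space M = {\<omega> \<in> space M. \<forall>j\<in>J1. X j \<omega> \<in> A (Inl j)}"
    by (auto simp: XA_def space_PiM)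
  also have "(\<lambda>\<omega> i. Y i \<omega>) -` YA \<inter> space M = {\<omega> \<in> space M. \<forall>j\<in>J2. Y j \<omega> \<in> A (Inr j)}"
    by (auto simp: YA_def space_PiM)
  also have "prob {\<omega> \<in> space M. \<forall>j\<in>J1. X j \<omega> \<in> A (Inl j)} = (\<Prod>j\<in>J1. prob (B (Inl j)))"
    using indep_vars_prob_Ball[OF X fin(1)] A1 B by (simp add: J12)
  also have "prob {\<omega> \<in> space M. \<forall>j\<in>J2. Y j \<omega> \<in> A (Inr j)} = (\<Prod>j\<in>J2. prob (B (Inr j)))"
    using indep_vars_prob_Ball[OF Y fin(2)] A2 B by (simp add: J12)
  also have "(\<Prod>j\<in>J1. prob (B (Inl j))) * (\<Prod>j\<in>J2. prob (B (Inr j))) = (\<Prod>j\<in>J. prob (B j))"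
    unfolding J12 using fin
    by (subst prod.union_disjoint) (auto simp: prod.reindex)
  finally show "prob (\<Inter>j\<in>J. B j) = (\<Prod>j\<in>J. prob (B j))" .
qed

text \<open>Fubini for the joint law of \<open>X\<close> and \<open>Y\<close>, which independence
  makes a product, pulled back to \<open>M\<close>. It plays the part of conditioning on
  \<open>X\<close>: inside, \<open>X\<close> is frozen and \<open>Y\<close> is averaged.\<close>

lemma indep_var_integral_iterated:
  fixes h :: "'b \<times> 'b \<Rightarrow> real"
  assumes ind: "indep_var N1 X N2 Y"
    and h [measurable]: "h \<in> borel_measurable (N1 \<Otimes>\<^sub>M N2)"
    and int: "integrable M (\<lambda>\<omega>. h (X \<omega>, Y \<omega>))"
  shows "integrable M (\<lambda>\<omega>. \<integral>\<omega>'. h (X \<omega>, Y \<omega>') \<partial>M)"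
    and "expectation (\<lambda>\<omega>. h (X \<omega>, Y \<omega>)) = expectation (\<lambda>\<omega>. \<integral>\<omega>'. h (X \<omega>, Y \<omega>') \<partial>M)"
proof -
  have X [measurable]: "X \<in> measurable M N1" and Y [measurable]: "Y \<in> measurable M N2"
    and D: "distr M N1 X \<Otimes>\<^sub>M distr M N2 Y = distr M (N1 \<Otimes>\<^sub>M N2) (\<lambda>x. (X x, Y x))"
    using ind unfolding indep_var_distribution_eq by auto
  interpret D1: prob_space "distr M N1 X" by (rule prob_space_distr) fact
  interpret D2: prob_space "distr M N2 Y" by (rule prob_space_distr) fact
  interpret P: pair_sigma_finite "distr M N1 X" "distr M N2 Y" ..
  have i: "integrable (distr M N1 X \<Otimes>\<^sub>M distr M N2 Y) h"
    unfolding D using int by (subst integrable_distr_eq) auto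
  have eq: "(\<integral>y. h (X \<omega>, y) \<partial>distr M N2 Y) = (\<integral>\<omega>'. h (X \<omega>, Y \<omega>') \<partial>M)" if "\<omega> \<in> space M" for \<omega>
    using measurable_space[OF X that] by (subst integral_distr) auto
  have "integrable (distr M N1 X) (\<lambda>x. \<integral>y. h (x, y) \<partial>distr M N2 Y)"
    using P.integrable_fst'[OF i] .
  then have "integrable M (\<lambda>\<omega>. \<integral>y. h (X \<omega>, y) \<partial>distr M N2 Y)"
    by (subst (asm) integrable_distr_eq) auto
  then show "integrable M (\<lambda>\<omega>. \<integral>\<omega>'. h (X \<omega>, Y \<omega>') \<partial>M)"
    by (subst Bochner_Integration.integrable_cong[OF refl eq[symmetric]]) auto
  have "expectation (\<lambda>\<omega>. h (X \<omega>, Y \<omega>)) = (\<integral>z. h z \<partial>(distr M N1 X \<Otimes>\<^sub>M distr M N2 Y))"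
    unfolding D by (subst integral_distr) auto
  also have "\<dots> = (\<integral>x. (\<integral>y. h (x, y) \<partial>distr M N2 Y) \<partial>distr M N1 X)"
    using P.integral_fst'[OF i] by simp
  also have "\<dots> = expectation (\<lambda>\<omega>. \<integral>y. h (X \<omega>, y) \<partial>distr M N2 Y)"
    by (subst integral_distr) auto
  also have "\<dots> = expectation (\<lambda>\<omega>. \<integral>\<omega>'. h (X \<omega>, Y \<omega>') \<partial>M)"
    by (intro Bochner_Integration.integral_cong refl eq)
  finally show "expectation (\<lambda>\<omega>. h (X \<omega>, Y \<omega>)) = \<dots>" .
qed

end

section \<open>Waiting times and prices as one independent family\<close>

context auction_model
begin

abbreviation X :: "nat \<Rightarrow> 'a \<Rightarrow> real" where "X \<equiv> interarrival T"

lemma arrival_eq_sum: "T n \<omega> = (\<Sum>i\<le>n. X i \<omega>)"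
  by (induction n) (simp_all add: interarrival_def)

lemma X_measurable [measurable]: "X i \<in> borel_measurable M"
  using interarrival_indep unfolding indep_vars_def by auto

lemma C_measurable [measurable]: "C i \<in> borel_measurable M"
  using price_indep unfolding indep_vars_def by auto

lemma T_measurable [measurable]: "T i \<in> borel_measurable M"
  using arrival_eq_sum[of i] by (subst measurable_cong[OF arrival_eq_sum]) measurable

lemma sets_P [measurable_cong, simp]: "sets P = sets borel"
  using price_law[of 0] by (metis sets_distr)

lemma X_nonneg: "AE \<omega> in M. 0 \<le> X i \<omega>"
  by (subst distributed_AE2[OF interarrival_exponential])
     (auto simp: exponential_density_def)

lemma C_nonneg: "AE \<omega> in M. 0 \<le> C i \<omega>"
proof -
  have "AE c in distr M borel (C i). 0 \<le> c"
    unfolding price_law by (rule price_nonneg)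
  then show ?thesis by (subst (asm) AE_distr_iff) (auto simp: measurable_def)
qed

text \<open>The prices are assumed independent of the arrival times. The waiting times are a
  measurable function of the whole sequence of arrival times, so they inherit this
  independence.\<close>

lemma indep_X_C: "indep_vars (\<lambda>_. borel) (case_sum X C) UNIV"
proof (rule indep_vars_case_sum[OF interarrival_indep price_indep])
  \<comment> \<open>\<open>interarrival\<close> acts on random variables; a deterministic sequence
    is fed to it as a family of functions on the one-point type \<open>unit\<close>.\<close>
  define D :: "(nat \<Rightarrow> real) \<Rightarrow> nat \<Rightarrow> real"
    where "D = (\<lambda>t i. interarrival (\<lambda>i _. t i) i ())"
  have "D \<in> measurable (\<Pi>\<^sub>M i\<in>UNIV. borel) (\<Pi>\<^sub>M i\<in>UNIV. borel)"
  proof (rule measurable_PiM_single')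
    show "(\<lambda>t. D t i) \<in> borel_measurable (\<Pi>\<^sub>M i\<in>UNIV. borel)" for i
      unfolding D_def by (cases i) (simp_all add: interarrival_def)
  qed auto
  from indep_var_compose[OF arrivals_prices_indep this measurable_ident]
  show "indep_var (\<Pi>\<^sub>M i\<in>UNIV. borel) (\<lambda>\<omega> i. X i \<omega>) (\<Pi>\<^sub>M i\<in>UNIV. borel) (\<lambda>\<omega> i. C i \<omega>)"
    by (simp add: D_def o_def interarrival_def)
qed

end

section \<open>Values of policies and the dynamic programming equation\<close>

text \<open>The bounds on the indices matter: the age just before auction \<open>n\<close> uses the
  arrival at \<open>n\<close>, but only the prices strictly before \<open>n\<close>. This is why the
  price \<open>C n\<close> is fresh at that moment.\<close>

lemma age_cong:
  assumes "\<And>i. i \<le> n \<Longrightarrow> t i = t' i" "\<And>i. i < n \<Longrightarrow> c i = c' i"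
  shows "age b \<tau> t c n = age b \<tau> t' c' n"
  using assms by (induction n) auto

lemma age_nonneg:
  assumes "0 \<le> \<tau>" "0 \<le> t 0" "\<And>i. t i \<le> t (Suc i)"
  shows "0 \<le> age b \<tau> t c n"
  using assms by (induction n) (auto simp: add_nonneg_nonneg)

lemma age_measurable:
  assumes [measurable]: "b \<in> borel_measurable borel"
    and t: "\<And>i. i \<le> n \<Longrightarrow> (\<lambda>\<omega>. t \<omega> i) \<in> borel_measurable N"
    and c: "\<And>i. i < n \<Longrightarrow> (\<lambda>\<omega>. c \<omega> i) \<in> borel_measurable N"
  shows "(\<lambda>\<omega>. age b \<tau> (t \<omega>) (c \<omega>) n) \<in> borel_measurable N"
  using t c
proof (induction n)
  case 0
  then show ?case by simp
next
  case (Suc n)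
  have [measurable]: "(\<lambda>\<omega>. age b \<tau> (t \<omega>) (c \<omega>) n) \<in> borel_measurable N"
    "(\<lambda>\<omega>. t \<omega> n) \<in> borel_measurable N" "(\<lambda>\<omega>. t \<omega> (Suc n)) \<in> borel_measurable N"
    "(\<lambda>\<omega>. c \<omega> n) \<in> borel_measurable N"
    using Suc by auto
  show ?case by simp
qed

locale auction_policy = auction_model M \<mu> T P C
  for M :: "'a measure" and \<mu> T P C +
  fixes k b :: "real \<Rightarrow> real" and \<gamma> \<tau> :: real
  assumes discount_pos: "0 < \<gamma>" and age_start: "0 \<le> \<tau>"
    and k_measurable [measurable]: "k \<in> borel_measurable borel"
    and b_measurable [measurable]: "b \<in> borel_measurable borel"
begin

definition A :: "nat \<Rightarrow> 'a \<Rightarrow> real" where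
  "A n \<omega> = age b \<tau> (\<lambda>i. T i \<omega>) (\<lambda>i. C i \<omega>) n"

definition D :: "nat \<Rightarrow> 'a \<Rightarrow> real" where
  "D n \<omega> = exp (- \<gamma> * T n \<omega>)"

definition win_prob :: "real \<Rightarrow> real" where
  "win_prob x = measure P {..<b x}"

definition mean_payoff :: "real \<Rightarrow> real" where
  "mean_payoff x = (\<integral>c. (k x - c) * of_bool (b x > c) \<partial>P)"

text \<open>The value now, at age \<open>x\<close>, of receiving \<open>f\<close> at the age of the
  next auction. It is \<open>\<mu>\<close> times the resolvent at \<open>\<mu> + \<gamma>\<close> of
  the uniform motion of the age.\<close>

definition next_value :: "(real \<Rightarrow> real) \<Rightarrow> real \<Rightarrow> real" where
  "next_value f x = (\<integral>s. exponential_density \<mu> s * (exp (- \<gamma> * s) * f (x + s)) \<partial>lborel)"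

lemma A_measurable [measurable]: "A n \<in> borel_measurable M"
  unfolding A_def by (rule age_measurable) auto

lemma D_measurable [measurable]: "D n \<in> borel_measurable M"
  unfolding D_def by measurable

lemma A_Suc: "A (Suc n) \<omega> = (if b (A n \<omega>) > C n \<omega> then 0 else A n \<omega>) + X (Suc n) \<omega>"
  by (simp add: A_def interarrival_def)

lemma D_Suc: "D (Suc n) \<omega> = D n \<omega> * exp (- \<gamma> * X (Suc n) \<omega>)"
  by (simp add: D_def interarrival_def exp_add[symmetric] algebra_simps)

text \<open>Waiting times and prices are nonnegative only almost surely. Over countably many
  auctions the exceptions form one null set, and off it ages are nonnegative and discount factors
  lie in (0,1].\<close>

lemma AE_all_nonneg:
  "AE \<omega> in M. (\<forall>n. 0 \<le> X n \<omega>) \<and> (\<forall>n. 0 \<le> C n \<omega>) \<and> (\<forall>n. 0 \<le> A n \<omega>) \<and> (\<forall>n. 0 < D n \<omega> \<and> D n \<omega> \<le> 1)"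
proof -
  have "AE \<omega> in M. \<forall>n. 0 \<le> X n \<omega>" "AE \<omega> in M. \<forall>n. 0 \<le> C n \<omega>"
    by (simp_all only: AE_all_countable X_nonneg C_nonneg simp_thms)
  then show ?thesis
  proof eventually_elim
    case (elim \<omega>)
    have "0 \<le> A n \<omega>" for n
      unfolding A_def
    proof (rule age_nonneg[OF age_start])
      show "0 \<le> T 0 \<omega>" using elim(1)[rule_format, of 0] by (simp add: interarrival_def)
      show "T i \<omega> \<le> T (Suc i) \<omega>" for i
        using elim(1)[rule_format, of "Suc i"] by (simp add: interarrival_def)
    qed
    moreover have "0 \<le> T n \<omega>" for n
      by (subst arrival_eq_sum, rule sum_nonneg) (rule elim(1)[rule_format])
    then have "0 < D n \<omega> \<and> D n \<omega> \<le> 1" for n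
      using discount_pos by (simp add: D_def)
    ultimately show ?case using elim by blast
  qed
qed

text \<open>The Markov property at auction \<open>n\<close>: discount factor and age are functions
  of the waiting times up to \<open>n\<close> and the prices before \<open>n\<close>, while the
  price \<open>C n\<close> and the next waiting time form a disjoint block of the same independent
  family.\<close>

lemma history_indep:
  "indep_var (borel \<Otimes>\<^sub>M borel) (\<lambda>\<omega>. (D n \<omega>, A n \<omega>)) (borel \<Otimes>\<^sub>M borel) (\<lambda>\<omega>. (C n \<omega>, X (Suc n) \<omega>))"
proof -
  define I J :: "(nat + nat) set" where "I = Inl ` {..n} \<union> Inr ` {..<n}" and "J = {Inr n, Inl (Suc n)}"
  define t :: "(nat + nat \<Rightarrow> real) \<Rightarrow> nat \<Rightarrow> real" where "t = (\<lambda>y i. \<Sum>j\<le>i. y (Inl j))"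
  define c :: "(nat + nat \<Rightarrow> real) \<Rightarrow> nat \<Rightarrow> real" where "c = (\<lambda>y i. y (Inr i))"
  have ind: "indep_var (PiM I (\<lambda>_. borel)) (\<lambda>\<omega>. restrict (\<lambda>i. case_sum X C i \<omega>) I)
      (PiM J (\<lambda>_. borel)) (\<lambda>\<omega>. restrict (\<lambda>i. case_sum X C i \<omega>) J)"
    by (rule indep_var_restrict[OF indep_X_C]) (auto simp: I_def J_def)
  have mt: "(\<lambda>y. t y i) \<in> borel_measurable (PiM I (\<lambda>_. borel))" if "i \<le> n" for i
    unfolding t_def using that
    by (intro borel_measurable_sum measurable_component_singleton) (auto simp: I_def)
  have mc: "(\<lambda>y. c y i) \<in> borel_measurable (PiM I (\<lambda>_. borel))" if "i < n" for i
    unfolding c_def using that by (intro measurable_component_singleton) (auto simp: I_def)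
  have m1: "(\<lambda>y. (exp (- \<gamma> * t y n), age b \<tau> (t y) (c y) n)) \<in>
      measurable (PiM I (\<lambda>_. borel)) (borel \<Otimes>\<^sub>M borel)"
    using mt mc b_measurable
    by (intro measurable_Pair age_measurable borel_measurable_exp[THEN measurable_compose] borel_measurable_times borel_measurable_const) auto
  have m2: "(\<lambda>y. (y (Inr n), y (Inl (Suc n)))) \<in> measurable (PiM J (\<lambda>_. borel)) (borel \<Otimes>\<^sub>M borel)"
    by (intro measurable_Pair measurable_component_singleton) (auto simp: J_def)
  let ?r = "\<lambda>\<omega>. restrict (\<lambda>i. case_sum X C i \<omega>) I"
  have t: "t (?r \<omega>) i = T i \<omega>" if "i \<le> n" for i \<omega>
  proof -
    have "t (?r \<omega>) i = (\<Sum>j\<le>i. X j \<omega>)"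
      unfolding t_def by (rule sum.cong) (use that in \<open>auto simp: I_def\<close>)
    then show ?thesis by (simp only: arrival_eq_sum[symmetric])
  qed
  have c: "c (?r \<omega>) i = C i \<omega>" if "i < n" for i \<omega>
    unfolding c_def using that by (auto simp: I_def)
  have e1: "(\<lambda>y. (exp (- \<gamma> * t y n), age b \<tau> (t y) (c y) n)) \<circ> ?r = (\<lambda>\<omega>. (D n \<omega>, A n \<omega>))"
  proof
    fix \<omega>
    have "age b \<tau> (t (?r \<omega>)) (c (?r \<omega>)) n = A n \<omega>"
      unfolding A_def by (rule age_cong) (rule t, assumption, rule c)
    then show "((\<lambda>y. (exp (- \<gamma> * t y n), age b \<tau> (t y) (c y) n)) \<circ> ?r) \<omega> = (D n \<omega>, A n \<omega>)"
      by (simp only: o_apply t[OF order_refl] D_def)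
  qed
  have e2: "(\<lambda>y. (y (Inr n), y (Inl (Suc n)))) \<circ> (\<lambda>\<omega>. restrict (\<lambda>i. case_sum X C i \<omega>) J) =
      (\<lambda>\<omega>. (C n \<omega>, X (Suc n) \<omega>))"
    by (auto simp: fun_eq_iff J_def)
  show ?thesis using indep_var_compose[OF ind m1 m2] unfolding e1 e2 .
qed

lemma price_wait_indep: "indep_var borel (C n) borel (X (Suc n))"
proof -
  let ?r = "\<lambda>I \<omega>. restrict (\<lambda>i. case_sum X C i \<omega>) I"
  have "indep_var borel ((\<lambda>y. y (Inr n)) \<circ> ?r {Inr n}) borel ((\<lambda>y. y (Inl (Suc n))) \<circ> ?r {Inl (Suc n)})"
    by (rule indep_var_compose[OF indep_var_restrict[OF indep_X_C]]) auto
  then show ?thesis by (simp add: o_def)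
qed

lemma win_prob_eq: "win_prob x = expectation (\<lambda>\<omega>. of_bool (b x > C n \<omega>))"
proof -
  have "win_prob x = measure (distr M borel (C n)) {..<b x}"
    by (simp add: win_prob_def price_law)
  also have "\<dots> = prob (C n -` {..<b x} \<inter> space M)"
    by (rule measure_distr) auto
  also have "\<dots> = expectation (indicator (C n -` {..<b x} \<inter> space M))"
    by simp
  also have "\<dots> = expectation (\<lambda>\<omega>. of_bool (b x > C n \<omega>))"
    by (intro Bochner_Integration.integral_cong) (auto simp: indicator_def)
  finally show ?thesis .
qed

lemma mean_payoff_eq: "mean_payoff x = expectation (\<lambda>\<omega>. (k x - C n \<omega>) * of_bool (b x > C n \<omega>))"
proof -
  have "mean_payoff x = (\<integral>c. (k x - c) * of_bool (b x > c) \<partial>distr M borel (C n))"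
    by (simp add: mean_payoff_def price_law)
  also have "\<dots> = expectation (\<lambda>\<omega>. (k x - C n \<omega>) * of_bool (b x > C n \<omega>))"
    by (rule integral_distr) measurable
  finally show ?thesis .
qed

lemma next_value_eq:
  assumes [measurable]: "f \<in> borel_measurable borel"
  shows "next_value f x = expectation (\<lambda>\<omega>. exp (- \<gamma> * X n \<omega>) * f (x + X n \<omega>))"
  unfolding next_value_def
  by (rule distributed_integral[OF interarrival_exponential])
     (auto simp: exponential_density_def intensity_pos less_imp_le)

text \<open>The Laplace transform of the waiting time at \<open>\<gamma>\<close>. Discounting tilts
  the exponential density of rate \<open>\<mu>\<close> into a multiple of the one of rate
  \<open>\<mu> + \<gamma>\<close>, which has total mass one.\<close>

lemma next_value_one: "next_value (\<lambda>_. 1) x = \<mu> / (\<mu> + \<gamma>)"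
proof -
  interpret E: prob_space "density lborel (exponential_density (\<mu> + \<gamma>))"
    using intensity_pos discount_pos by (intro prob_space_exponential_density) auto
  have "(\<integral>s. exponential_density (\<mu> + \<gamma>) s * 1 \<partial>lborel) = (\<integral>s. 1 \<partial>density lborel (exponential_density (\<mu> + \<gamma>)))"
    using intensity_pos discount_pos by (subst integral_real_density) (auto simp: exponential_density_def)
  also have "\<dots> = 1" using E.prob_space by simp
  finally have "(\<integral>s. \<mu> / (\<mu> + \<gamma>) * exponential_density (\<mu> + \<gamma>) s \<partial>lborel) = \<mu> / (\<mu> + \<gamma>)"
    by simp
  moreover have "exponential_density \<mu> s * (exp (- \<gamma> * s) * 1) = \<mu> / (\<mu> + \<gamma>) * exponential_density (\<mu> + \<gamma>) s" for s
  proof -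
    have "\<mu> + \<gamma> \<noteq> 0" using intensity_pos discount_pos by simp
    moreover have "exp (- s * \<mu>) * exp (- \<gamma> * s) = exp (- s * (\<mu> + \<gamma>))"
      by (simp add: exp_add[symmetric] algebra_simps)
    ultimately show ?thesis
      by (simp add: exponential_density_def mult.assoc)
  qed
  ultimately show ?thesis unfolding next_value_def by simp
qed

lemma win_prob_measurable [measurable]: "win_prob \<in> borel_measurable borel"
  unfolding win_prob_eq[of _ 0, abs_def] by measurable

lemma next_value_measurable [measurable]:
  assumes [measurable]: "f \<in> borel_measurable borel"
  shows "next_value f \<in> borel_measurable borel"
  unfolding next_value_def[abs_def] by measurable

section \<open>Discounted moments along the sequence of auctions\<close>

lemma integrable_bounded:
  fixes Z :: "'a \<Rightarrow> real"
  assumes [measurable]: "Z \<in> borel_measurable M" and "AE \<omega> in M. \<bar>Z \<omega>\<bar> \<le> B"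
  shows "integrable M Z"
  by (rule integrable_const_bound[where B = B]) (use assms in auto)

lemma abs_D_mult_le:
  assumes "0 < d \<and> d \<le> (1::real)" "\<bar>y\<bar> \<le> B"
  shows "\<bar>d * y\<bar> \<le> B"
proof -
  have "\<bar>d * y\<bar> = d * \<bar>y\<bar>" using assms by (simp add: abs_mult)
  also have "\<dots> \<le> 1 * \<bar>y\<bar>" using assms by (intro mult_right_mono) auto
  finally show ?thesis using assms by simp
qed

lemma integrable_D_f:
  assumes [measurable]: "f \<in> borel_measurable borel" and B: "\<And>x. \<bar>f x\<bar> \<le> B"
  shows "integrable M (\<lambda>\<omega>. D n \<omega> * f (A n \<omega>))"
proof (rule integrable_bounded[where B = B])
  show "AE \<omega> in M. \<bar>D n \<omega> * f (A n \<omega>)\<bar> \<le> B"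
    using AE_all_nonneg by eventually_elim (use B in \<open>auto intro!: abs_D_mult_le\<close>)
qed auto

text \<open>One step of the chain: given discount factor and age at auction \<open>n\<close>, a win
  restarts the age at \<open>0\<close> and a loss keeps it, after which an independent exponential
  time passes. Conditioning is done twice, first on the history and then on the price.\<close>

lemma discounted_moment_Suc:
  assumes [measurable]: "f \<in> borel_measurable borel" and B: "\<And>x. \<bar>f x\<bar> \<le> B"
  shows "expectation (\<lambda>\<omega>. D (Suc n) \<omega> * f (A (Suc n) \<omega>)) =
    expectation (\<lambda>\<omega>. D n \<omega> * (win_prob (A n \<omega>) * next_value f 0 +
      (1 - win_prob (A n \<omega>)) * next_value f (A n \<omega>)))"
proof -
  define h :: "(real \<times> real) \<times> (real \<times> real) \<Rightarrow> real"
    where "h = (\<lambda>z. fst (fst z) * exp (- \<gamma> * snd (snd z)) *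
      f ((if b (snd (fst z)) > fst (snd z) then 0 else snd (fst z)) + snd (snd z)))"
  have h: "h \<in> borel_measurable ((borel \<Otimes>\<^sub>M borel) \<Otimes>\<^sub>M (borel \<Otimes>\<^sub>M borel))"
    unfolding h_def by measurable
  have h_eq: "h ((D n \<omega>, A n \<omega>), (C n \<omega>, X (Suc n) \<omega>)) = D (Suc n) \<omega> * f (A (Suc n) \<omega>)" for \<omega>
    by (simp only: h_def fst_conv snd_conv D_Suc A_Suc)
  have "integrable M (\<lambda>\<omega>. h ((D n \<omega>, A n \<omega>), (C n \<omega>, X (Suc n) \<omega>)))"
    unfolding h_eq by (rule integrable_D_f[OF assms])
  note iterated = indep_var_integral_iterated(2)[OF history_indep h this]
  have inner: "(\<integral>\<omega>'. h ((d, x), (C n \<omega>', X (Suc n) \<omega>')) \<partial>M) =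
      d * (win_prob x * next_value f 0 + (1 - win_prob x) * next_value f x)" for d x
  proof -
    define g :: "real \<times> real \<Rightarrow> real"
      where "g = (\<lambda>z. exp (- \<gamma> * snd z) * f ((if b x > fst z then 0 else x) + snd z))"
    have g: "g \<in> borel_measurable (borel \<Otimes>\<^sub>M borel)"
      unfolding g_def by measurable
    have [measurable]: "(\<lambda>\<omega>. g (C n \<omega>, X (Suc n) \<omega>)) \<in> borel_measurable M"
      unfolding g_def by measurable
    have "AE \<omega> in M. \<bar>g (C n \<omega>, X (Suc n) \<omega>)\<bar> \<le> B"
      unfolding g_def fst_conv snd_conv
      using X_nonneg[of "Suc n"] by eventually_elim (use B discount_pos in \<open>auto intro!: abs_D_mult_le\<close>)
    then have gi: "integrable M (\<lambda>\<omega>. g (C n \<omega>, X (Suc n) \<omega>))"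
      by (intro integrable_bounded) auto
    have "(\<integral>\<omega>'. h ((d, x), (C n \<omega>', X (Suc n) \<omega>')) \<partial>M) = d * (\<integral>\<omega>'. g (C n \<omega>', X (Suc n) \<omega>') \<partial>M)"
      by (simp only: h_def g_def fst_conv snd_conv mult.assoc integral_mult_right_zero)
    \<comment> \<open>The price is averaged outside and the waiting time inside, so the inner
      integral is \<open>next_value f\<close> at \<open>0\<close> or at \<open>x\<close>, according
      to the outcome of the auction.\<close>
    also have "(\<integral>\<omega>'. g (C n \<omega>', X (Suc n) \<omega>') \<partial>M) =
        expectation (\<lambda>\<omega>. \<integral>\<omega>'. g (C n \<omega>, X (Suc n) \<omega>') \<partial>M)"
      by (rule indep_var_integral_iterated(2)[OF price_wait_indep g gi])
    also have "(\<lambda>\<omega>. \<integral>\<omega>'. g (C n \<omega>, X (Suc n) \<omega>') \<partial>M) =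
        (\<lambda>\<omega>. next_value f (if b x > C n \<omega> then 0 else x))"
      unfolding g_def fst_conv snd_conv by (subst next_value_eq[of f _ "Suc n"]) auto
    also have "\<dots> = (\<lambda>\<omega>. of_bool (b x > C n \<omega>) * (next_value f 0 - next_value f x) + next_value f x)"
      by auto
    also have "expectation \<dots> = win_prob x * (next_value f 0 - next_value f x) + next_value f x"
    proof -
      have "integrable M (\<lambda>\<omega>. of_bool (b x > C n \<omega>) :: real)"
        by (rule integrable_bounded[where B = 1]) auto
      then show ?thesis
        by (subst Bochner_Integration.integral_add) (auto simp: win_prob_eq[of x n] prob_space)
    qed
    finally show ?thesis by (simp add: algebra_simps)
  qed
  show ?thesis using iterated unfolding h_eq inner .
qed

lemma discounted_moment_0:
  assumes [measurable]: "f \<in> borel_measurable borel"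
  shows "expectation (\<lambda>\<omega>. D 0 \<omega> * f (A 0 \<omega>)) = next_value f \<tau>"
  by (subst next_value_eq[of f _ 0]) (auto simp: D_def A_def interarrival_def)

text \<open>The one-step formula for the constant function 1: each waiting time contributes the same
  factor. The exponent is \<open>Suc n\<close> because auctions are counted from \<open>0\<close>
  and auction \<open>0\<close> already lies one waiting time ahead.\<close>

lemma expectation_D: "expectation (D n) = (\<mu> / (\<mu> + \<gamma>)) ^ Suc n"
proof (induction n)
  case 0
  then show ?case using discounted_moment_0[of "\<lambda>_. 1"] by (simp add: next_value_one)
next
  case (Suc n)
  have "expectation (D (Suc n)) = expectation (\<lambda>\<omega>. D n \<omega> * (\<mu> / (\<mu> + \<gamma>)))"
  proof -
    have "p * q + (1 - p) * q = q" for p q :: real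
      by (simp add: algebra_simps)
    then show ?thesis
      using discounted_moment_Suc[of "\<lambda>_. 1" 1 n] by (simp only: next_value_one) simp
  qed
  then show ?case using Suc by simp
qed

lemma integrable_D [simp]: "integrable M (D n)"
  using integrable_D_f[of "\<lambda>_. 1" 1 n] by simp

lemma discount_ratio: "0 < \<mu> / (\<mu> + \<gamma>)" "\<mu> / (\<mu> + \<gamma>) < 1"
  using intensity_pos discount_pos by auto

lemma summable_expectation_D: "summable (\<lambda>n. expectation (D n))"
  unfolding expectation_D using discount_ratio
  by (subst summable_Suc_iff) (intro summable_geometric, simp only: real_norm_def abs_of_pos)

text \<open>The expected sum of the discount factors is a convergent geometric series, so the sum
  itself is finite almost surely. This gives pathwise convergence of the discounted payoffs.\<close>

lemma AE_summable_D: "AE \<omega> in M. summable (\<lambda>n. D n \<omega>)"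
proof -
  have "(\<integral>\<^sup>+\<omega>. (\<Sum>n. ennreal (D n \<omega>)) \<partial>M) = (\<Sum>n. \<integral>\<^sup>+\<omega>. ennreal (D n \<omega>) \<partial>M)"
    by (rule nn_integral_suminf) auto
  also have "\<dots> = (\<Sum>n. ennreal (expectation (D n)))"
    by (subst nn_integral_eq_integral[OF integrable_D]) (auto simp: D_def)
  also have "\<dots> \<noteq> \<infinity>"
    using summable_expectation_D by (subst suminf_ennreal2) (auto simp: D_def[abs_def])
  finally have "AE \<omega> in M. (\<Sum>n. ennreal (D n \<omega>)) \<noteq> \<infinity>"
    by (intro nn_integral_PInf_AE) auto
  then show ?thesis
    by eventually_elim (auto intro!: summable_suminf_not_top simp: D_def)
qed

text \<open>A bounded solution \<open>f\<close> of the dynamic programming equation makes the expected discounted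
  payoffs telescope.\<close>

lemma policy_value_eq:
  assumes f_measurable [measurable]: "f \<in> borel_measurable borel" and B: "\<And>x. \<bar>f x\<bar> \<le> B"
    and payoff: "\<And>x c. 0 \<le> x \<Longrightarrow> 0 \<le> c \<Longrightarrow> \<bar>(k x - c) * of_bool (b x > c)\<bar> \<le> L"
    and eq: "\<And>x. 0 \<le> x \<Longrightarrow>
      f x = mean_payoff x + win_prob x * next_value f 0 + (1 - win_prob x) * next_value f x"
  shows "policy_value M T C k b \<gamma> \<tau> = next_value f \<tau>"
proof -
  define R where "R = (\<lambda>n \<omega>. D n \<omega> * ((k (A n \<omega>) - C n \<omega>) * of_bool (b (A n \<omega>) > C n \<omega>)))"
  have R_measurable [measurable]: "R n \<in> borel_measurable M" for n
    unfolding R_def by measurable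
  have R_le: "AE \<omega> in M. \<forall>n. \<bar>R n \<omega>\<bar> \<le> D n \<omega> * L"
    using AE_all_nonneg
  proof eventually_elim
    case (elim \<omega>)
    then have "\<bar>R n \<omega>\<bar> = D n \<omega> * \<bar>(k (A n \<omega>) - C n \<omega>) * of_bool (b (A n \<omega>) > C n \<omega>)\<bar>" for n
      unfolding R_def by (subst abs_mult) (simp add: less_imp_le)
    then show ?case using elim payoff by (auto intro!: mult_left_mono simp: less_imp_le)
  qed
  have R_int: "integrable M (R n)" for n
    by (rule Bochner_Integration.integrable_bound[of M "\<lambda>\<omega>. D n \<omega> * L"])
       (use R_le in \<open>auto elim!: eventually_mono intro: order_trans[OF _ abs_ge_self]\<close>)
  have "L \<ge> 0" using payoff[of 0 0] by linarith
  \<comment> \<open>Given the history the price \<open>C n\<close> is fresh, so the payoff of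
    auction \<open>n\<close> may be replaced by its mean at the age \<open>A n\<close>.\<close>
  have m: "expectation (R n) = expectation (\<lambda>\<omega>. D n \<omega> * mean_payoff (A n \<omega>))"
    and mi: "integrable M (\<lambda>\<omega>. D n \<omega> * mean_payoff (A n \<omega>))" for n
  proof -
    define h :: "(real \<times> real) \<times> (real \<times> real) \<Rightarrow> real"
      where "h = (\<lambda>z. fst (fst z) * ((k (snd (fst z)) - fst (snd z)) * of_bool (b (snd (fst z)) > fst (snd z))))"
    have h: "h \<in> borel_measurable ((borel \<Otimes>\<^sub>M borel) \<Otimes>\<^sub>M (borel \<Otimes>\<^sub>M borel))"
      unfolding h_def by measurable
    have h_eq: "h ((D n \<omega>, A n \<omega>), (C n \<omega>, X (Suc n) \<omega>)) = R n \<omega>" for \<omega>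
      by (simp only: h_def R_def fst_conv snd_conv)
    have hi: "integrable M (\<lambda>\<omega>. h ((D n \<omega>, A n \<omega>), (C n \<omega>, X (Suc n) \<omega>)))"
      unfolding h_eq by (rule R_int)
    have inner: "(\<integral>\<omega>'. h ((d, x), (C n \<omega>', X (Suc n) \<omega>')) \<partial>M) = d * mean_payoff x" for d x
      by (simp only: h_def mean_payoff_eq[of x n] fst_conv snd_conv integral_mult_right_zero)
    show "expectation (R n) = expectation (\<lambda>\<omega>. D n \<omega> * mean_payoff (A n \<omega>))"
      "integrable M (\<lambda>\<omega>. D n \<omega> * mean_payoff (A n \<omega>))"
      using indep_var_integral_iterated[OF history_indep h hi] unfolding h_eq inner by simp_all
  qed
  define E where "E = (\<lambda>n. expectation (\<lambda>\<omega>. D n \<omega> * f (A n \<omega>)))"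
  \<comment> \<open>At the age \<open>A n\<close> the equation for \<open>f\<close> says that the
    continuation term of the one-step formula is \<open>f\<close> minus the mean payoff. It is
    available for nonnegative ages, hence almost surely.\<close>
  have step: "expectation (R n) = E n - E (Suc n)" for n
  proof -
    have "E (Suc n) = expectation (\<lambda>\<omega>. D n \<omega> * f (A n \<omega>) - D n \<omega> * mean_payoff (A n \<omega>))"
      unfolding E_def discounted_moment_Suc[OF f_measurable B]
    proof (rule integral_cong_AE)
      show "AE \<omega> in M. D n \<omega> * (win_prob (A n \<omega>) * next_value f 0 +
          (1 - win_prob (A n \<omega>)) * next_value f (A n \<omega>)) =
        D n \<omega> * f (A n \<omega>) - D n \<omega> * mean_payoff (A n \<omega>)"
        using AE_all_nonneg by eventually_elim (simp add: eq algebra_simps)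
      show m1: "(\<lambda>\<omega>. D n \<omega> * f (A n \<omega>) - D n \<omega> * mean_payoff (A n \<omega>)) \<in> borel_measurable M"
        using integrable_D_f[OF f_measurable B] mi by (intro borel_measurable_diff borel_measurable_integrable)
      show "(\<lambda>\<omega>. D n \<omega> * (win_prob (A n \<omega>) * next_value f 0 +
          (1 - win_prob (A n \<omega>)) * next_value f (A n \<omega>))) \<in> borel_measurable M"
        by measurable
    qed
    also have "\<dots> = E n - expectation (R n)"
      unfolding m E_def
      by (rule Bochner_Integration.integral_diff[OF integrable_D_f[OF f_measurable B] mi])
    finally show ?thesis by simp
  qed
  \<comment> \<open>Since \<open>f\<close> is bounded, the remainder decays like the expected
    discount factor.\<close>
  have E_lim: "E \<longlonglongrightarrow> 0"
  proof (rule Lim_null_comparison)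
    show "\<forall>\<^sub>F n in sequentially. norm (E n) \<le> B * expectation (D n)"
    proof (intro always_eventually allI)
      fix n
      have "norm (E n) \<le> expectation (\<lambda>\<omega>. norm (D n \<omega> * f (A n \<omega>)))"
        unfolding E_def by (rule integral_norm_bound)
      also have "\<dots> \<le> expectation (\<lambda>\<omega>. B * D n \<omega>)"
      proof (rule integral_mono)
        show "integrable M (\<lambda>\<omega>. norm (D n \<omega> * f (A n \<omega>)))"
          by (rule integrable_norm[OF integrable_D_f[OF f_measurable B]])
        have "0 < D n \<omega>" for \<omega> by (simp add: D_def)
        then show "norm (D n \<omega> * f (A n \<omega>)) \<le> B * D n \<omega>" for \<omega>
          using B by (simp add: abs_mult mult.commute mult_left_mono less_imp_le)
      qed simp
      finally show "norm (E n) \<le> B * expectation (D n)" by simp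
    qed
    show "(\<lambda>n. B * expectation (D n)) \<longlonglongrightarrow> 0"
      using tendsto_mult_right_zero[OF summable_LIMSEQ_zero[OF summable_expectation_D]] .
  qed
  have "policy_value M T C k b \<gamma> \<tau> = expectation (\<lambda>\<omega>. \<Sum>n. R n \<omega>)"
    unfolding policy_value_def discounted_payoff_def R_def D_def A_def by (simp add: mult.assoc)
  \<comment> \<open>Sum and expectation are exchanged with the dominating series of terms
    \<open>D n * L\<close>, summable both pathwise and in expectation.\<close>
  also have "\<dots> = (\<Sum>n. expectation (R n))"
  proof (rule integral_suminf[OF R_int])
    show "AE \<omega> in M. summable (\<lambda>n. norm (R n \<omega>))"
      using R_le AE_summable_D
    proof eventually_elim
      case (elim \<omega>)
      show ?case
        by (rule summable_comparison_test'[OF summable_mult2[OF elim(2), of L], of 0]) (use elim(1) in simp)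
    qed
    have "expectation (\<lambda>\<omega>. norm (R n \<omega>)) \<le> expectation (\<lambda>\<omega>. D n \<omega> * L)" for n
      using R_int[of n] R_le by (intro integral_mono_AE) (auto elim!: eventually_mono)
    then show "summable (\<lambda>n. expectation (\<lambda>\<omega>. norm (R n \<omega>)))"
      by (intro summable_comparison_test'[OF summable_mult2[OF summable_expectation_D, of L], of 0]) auto
  qed
  also have "\<dots> = (\<Sum>n. E n - E (Suc n))"
    by (simp add: step)
  also have "\<dots> = E 0 - 0"
    using telescope_sums'[OF E_lim] by (simp add: sums_iff)
  also have "E 0 = next_value f \<tau>"
    unfolding E_def by (rule discounted_moment_0) simp
  finally show ?thesis by simp
qed

end

section \<open>Improper integrals\<close>

text \<open>The fundamental theorem on \<open>{a..b}\<close>, followed by the limit in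
  \<open>b\<close>; integrability of \<open>f\<close> ensures that the integrals over
  \<open>{a..b}\<close> converge to the one over the half-line.\<close>

lemma set_integral_FTC_atLeast:
  fixes F f :: "real \<Rightarrow> real"
  assumes F: "\<And>x. a \<le> x \<Longrightarrow> (F has_real_derivative f x) (at x within {a..})"
    and f: "set_integrable lborel {a..} f" and lim: "(F \<longlongrightarrow> L) at_top"
  shows "(LBINT x:{a..}. f x) = L - F a"
proof -
  have "((\<lambda>b. LBINT x:{a..b}. f x) \<longlongrightarrow> (LBINT x:{a..}. f x)) at_top"
    by (rule tendsto_set_lebesgue_integral_at_top[OF _ f]) auto
  moreover have "((\<lambda>b. LBINT x:{a..b}. f x) \<longlongrightarrow> L - F a) at_top"
  proof (rule Lim_transform_eventually)
    show "((\<lambda>b. F b - F a) \<longlongrightarrow> L - F a) at_top"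
      by (intro tendsto_intros lim)
    show "\<forall>\<^sub>F b in at_top. F b - F a = (LBINT x:{a..b}. f x)"
    proof (rule eventually_at_top_linorderI)
      fix b assume "a \<le> b"
      have "(f has_integral F b - F a) {a..b}"
      proof (rule fundamental_theorem_of_calculus[OF \<open>a \<le> b\<close>])
        fix x assume "x \<in> {a..b}"
        then have "(F has_real_derivative f x) (at x within {a..b})"
          by (intro DERIV_subset[OF F]) auto
        then show "(F has_vector_derivative f x) (at x within {a..b})"
          by (simp only: has_real_derivative_iff_has_vector_derivative)
      qed
      moreover have "set_integrable lborel {a..b} f"
        by (rule set_integrable_subset[OF f]) auto
      ultimately show "F b - F a = (LBINT x:{a..b}. f x)"
        by (simp add: set_borel_integral_eq_integral(2) integral_unique)
    qed
  qed
  ultimately show ?thesis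
    by (rule tendsto_unique[OF trivial_limit_at_top_linorder])
qed

text \<open>The tail is a constant minus a proper integral from \<open>a\<close>, whose derivative
  is the integrand. At \<open>x = a\<close> the derivative is one-sided.\<close>

lemma has_real_derivative_tail_integral:
  fixes f :: "real \<Rightarrow> real"
  assumes f: "continuous_on {a..} f" and int: "set_integrable lborel {a..} f" and "a \<le> x"
  shows "((\<lambda>x. LBINT u:{x..}. f u) has_real_derivative - f x) (at x within {a..})"
proof -
  have eq: "(LBINT u:{y..}. f u) = (LBINT u:{a..}. f u) - integral {a..y} f" if "a \<le> y" for y
  proof -
    have i: "set_integrable lborel {a..<y} f" "set_integrable lborel {a..y} f" "set_integrable lborel {y..} f"
      using that by (auto intro: set_integrable_subset[OF int])
    have "{a..} = {a..<y} \<union> {y..}" and disjoint: "{a..<y} \<inter> {y..} = {}" using that by auto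
    then have "(LBINT u:{a..}. f u) = (LBINT u:{a..<y}. f u) + (LBINT u:{y..}. f u)"
      using set_integral_Un[OF disjoint i(1,3)] by (simp only:)
    also have "(LBINT u:{a..<y}. f u) = integral {a..<y} f"
      by (rule set_borel_integral_eq_integral(2)[OF i(1)])
    also have "\<dots> = integral {a..y} f"
      by (rule integral_subset_negligible) (auto intro!: negligible_subset[OF negligible_sing[of y]])
    finally show ?thesis by simp
  qed
  have "((\<lambda>y. integral {a..y} f) has_real_derivative f x) (at x within {a..x + 1})"
    using \<open>a \<le> x\<close> by (intro integral_has_real_derivative continuous_on_subset[OF f]) auto
  \<comment> \<open>Differentiability of the proper integral is obtained on a compact interval; near
    \<open>x\<close> this interval and the half-line coincide.\<close>
  also have "at x within {a..x + 1} = at x within {a..}"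
    by (rule at_within_nhd[of _ "{x - 1<..<x + 1}"]) auto
  finally have "((\<lambda>y. (LBINT u:{a..}. f u) - integral {a..y} f) has_real_derivative 0 - f x) (at x within {a..})"
    by (intro derivative_intros)
  then have "((\<lambda>y. LBINT u:{y..}. f u) has_real_derivative 0 - f x) (at x within {a..})"
    proof (rule has_field_derivative_transform_within[of _ _ _ _ 1])
    show "(LBINT u:{a..}. f u) - integral {a..y} f = (LBINT u:{y..}. f u)" if "y \<in> {a..}" for y
      using eq[of y] that by simp
  qed (use \<open>a \<le> x\<close> in auto)
  then show ?thesis by simp
qed

lemma exp_decay_tendsto:
  fixes c l :: real
  assumes "0 < l" shows "((\<lambda>u. c * exp (- l * u)) \<longlongrightarrow> 0) at_top"
  using assms by real_asymp

lemma set_integrable_exp: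
  assumes "0 < (l::real)"
  shows "set_integrable lborel {0..} (\<lambda>x. exp (- l * x))"
proof -
  interpret E: prob_space "density lborel (exponential_density l)"
    using assms by (rule prob_space_exponential_density)
  have "integrable (density lborel (exponential_density l)) (\<lambda>_. 1::real)"
    by simp
  then have "integrable lborel (exponential_density l)"
    using assms by (subst (asm) integrable_real_density) (auto simp: exponential_density_nonneg)
  then have "integrable lborel (\<lambda>x. (1 / l) * exponential_density l x)"
    by (rule integrable_mult_right)
  also have "(\<lambda>x. (1 / l) * exponential_density l x) = (\<lambda>x. indicator {0..} x *\<^sub>R exp (- l * x))"
    using assms by (auto simp: exponential_density_def fun_eq_iff indicator_def)
  finally show ?thesis unfolding set_integrable_def .
qed

lemma set_integrable_mult_bounded:
  fixes f g :: "real \<Rightarrow> real"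
  assumes f: "set_integrable lborel A f"
    and g [measurable]: "g \<in> borel_measurable borel" and B: "\<And>x. x \<in> A \<Longrightarrow> \<bar>g x\<bar> \<le> B"
  shows "set_integrable lborel A (\<lambda>x. g x * f x)"
proof -
  have "set_integrable lborel A (\<lambda>x. B * f x)"
    using f by auto
  then show ?thesis
  proof (rule set_integrable_bound)
    \<comment> \<open>The indicator stays attached to \<open>f\<close>, whose measurability is known
      only on \<open>A\<close>.\<close>
    have "(\<lambda>x. g x * (indicator A x *\<^sub>R f x)) \<in> borel_measurable lborel"
      using f unfolding set_integrable_def
      by (intro borel_measurable_times) auto
    also have "(\<lambda>x. g x * (indicator A x *\<^sub>R f x)) = (\<lambda>x. indicator A x *\<^sub>R (g x * f x))"
      by (auto simp: indicator_def)
    finally show "set_borel_measurable lborel A (\<lambda>x. g x * f x)"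
      unfolding set_borel_measurable_def .
    show "AE x in lborel. x \<in> A \<longrightarrow> norm (g x * f x) \<le> norm (B * f x)"
      using B by (auto simp: abs_mult intro!: mult_right_mono order_trans[OF B abs_ge_self])
  qed
qed

lemma set_integral_shift:
  fixes f :: "real \<Rightarrow> real"
  shows "(LBINT u:{x..}. f u) = (LBINT s:{0..}. f (x + s))"
  unfolding set_lebesgue_integral_def
  by (subst lborel_integral_real_affine[of 1 _ x]) (auto simp: indicator_def intro!: Bochner_Integration.integral_cong)

section \<open>Survival of the age between two wins\<close>

definition value_at_age :: "real \<Rightarrow> real" where
  "value_at_age t = 1 - 1 / (1 + t)"

lemma value_at_age_measurable [measurable]: "value_at_age \<in> borel_measurable borel"
  unfolding value_at_age_def[abs_def] by measurable

lemma value_at_age_bounds: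
  assumes "0 \<le> t" shows "0 \<le> value_at_age t" "value_at_age t \<le> 1"
  using assms by (auto simp: value_at_age_def field_simps)

lemma continuous_on_value_at_age [continuous_intros]: "continuous_on {0..} value_at_age"
  unfolding value_at_age_def[abs_def] by (intro continuous_intros) auto

text \<open>The discounted probability that no auction is won up to age \<open>u\<close>, wins occurring at rate
  \<open>a * value_at_age u\<close>.\<close>

definition disc_surv :: "real \<Rightarrow> real \<Rightarrow> real \<Rightarrow> real" where
  "disc_surv \<gamma> a u = exp (- (\<gamma> + a) * u) * (1 + u) powr a"

lemma disc_surv_measurable [measurable]: "disc_surv \<gamma> a \<in> borel_measurable borel"
  unfolding disc_surv_def[abs_def] by measurable

lemma disc_surv_pos: "-1 < u \<Longrightarrow> 0 < disc_surv \<gamma> a u"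
  by (simp add: disc_surv_def)

lemma disc_surv_0 [simp]: "disc_surv \<gamma> a 0 = 1"
  by (simp add: disc_surv_def)

text \<open>The logarithmic derivative is \<open>- (\<gamma> + a) + a / (1 + u)\<close>, that is,
  minus the sum of the discount rate and the win rate at age \<open>u\<close>.\<close>

lemma disc_surv_deriv:
  assumes "-1 < u"
  shows "(disc_surv \<gamma> a has_real_derivative - (\<gamma> + a * value_at_age u) * disc_surv \<gamma> a u) (at u within S)"
proof -
  have "(disc_surv \<gamma> a has_real_derivative
      exp (- (\<gamma> + a) * u) * (- (\<gamma> + a)) * (1 + u) powr a +
      (a * (1 + u) powr (a - 1)) * exp (- (\<gamma> + a) * u)) (at u)"
    unfolding disc_surv_def[abs_def] using assms
    by (auto intro!: derivative_eq_intros simp: powr_diff)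
  also have "(1 + u) powr (a - 1) = (1 + u) powr a / (1 + u)"
    using assms by (simp add: powr_diff)
  also have "exp (- (\<gamma> + a) * u) * (- (\<gamma> + a)) * (1 + u) powr a +
      (a * ((1 + u) powr a / (1 + u))) * exp (- (\<gamma> + a) * u) =
      - (\<gamma> + a * value_at_age u) * disc_surv \<gamma> a u"
    unfolding disc_surv_def value_at_age_def divide_inverse by algebra
  finally show ?thesis by (rule has_field_derivative_at_within)
qed

lemma continuous_on_disc_surv [continuous_intros]: "continuous_on {0..} (disc_surv \<gamma> a)"
  by (rule DERIV_continuous_on[OF disc_surv_deriv]) auto

text \<open>Half of the decay \<open>exp (- a * u)\<close> absorbs the power, because
  \<open>1 + u\<close> is at most \<open>2 * exp (u / 2)\<close>; this is the tangent bound for the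
  exponential at \<open>(u - 1) / 2\<close>.\<close>

lemma disc_surv_le_exp:
  assumes "0 \<le> \<gamma>" "0 \<le> a" "0 \<le> u"
  shows "disc_surv \<gamma> a u \<le> 2 powr a * exp (- (\<gamma> + a / 2) * u)"
proof -
  have "exp ((u - 1) / 2) \<le> exp (u / 2)" by simp
  from order_trans[OF exp_ge_add_one_self this] have "1 + u \<le> 2 * exp (u / 2)"
    by (simp add: field_simps)
  then have "(1 + u) powr a \<le> (2 * exp (u / 2)) powr a"
    using assms by (intro powr_mono2) auto
  also have "\<dots> = 2 powr a * exp (a / 2 * u)"
    by (simp add: powr_mult exp_powr_real mult.commute)
  finally have "disc_surv \<gamma> a u \<le> exp (- (\<gamma> + a) * u) * (2 powr a * exp (a / 2 * u))"
    unfolding disc_surv_def by (intro mult_left_mono) auto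
  also have "\<dots> = 2 powr a * exp (- (\<gamma> + a / 2) * u)"
    by (simp add: exp_add[symmetric] algebra_simps)
  finally show ?thesis .
qed

lemma disc_surv_integrable:
  assumes "0 \<le> \<gamma>" "0 < a"
  shows "set_integrable lborel {0..} (disc_surv \<gamma> a)"
proof -
  have "set_integrable lborel {0..} (\<lambda>u. 2 powr a * exp (- (\<gamma> + a / 2) * u))"
    using set_integrable_exp[of "\<gamma> + a / 2"] assms by auto
  then show ?thesis
  proof (rule set_integrable_bound)
    show "set_borel_measurable lborel {0..} (disc_surv \<gamma> a)"
      unfolding set_borel_measurable_def by measurable
    show "AE x in lborel. x \<in> {0..} \<longrightarrow> norm (disc_surv \<gamma> a x) \<le> norm (2 powr a * exp (- (\<gamma> + a / 2) * x))"
      using disc_surv_le_exp[of \<gamma> a] assms disc_surv_pos[of _ \<gamma> a]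
      by (auto simp: abs_of_pos)
  qed
qed

lemma disc_surv_tendsto:
  assumes "0 \<le> \<gamma>" "0 < a"
  shows "(disc_surv \<gamma> a \<longlongrightarrow> 0) at_top"
proof (rule tendsto_sandwich)
  show "\<forall>\<^sub>F u in at_top. 0 \<le> disc_surv \<gamma> a u"
    by (auto simp: disc_surv_def)
  show "\<forall>\<^sub>F u in at_top. disc_surv \<gamma> a u \<le> 2 powr a * exp (- (\<gamma> + a / 2) * u)"
    using disc_surv_le_exp assms by (intro eventually_at_top_linorderI[of 0]) auto
  show "((\<lambda>u. 2 powr a * exp (- (\<gamma> + a / 2) * u)) \<longlongrightarrow> 0) at_top"
    by (rule exp_decay_tendsto) (use assms in simp)
qed simp

text \<open>Submultiplicativity, from \<open>1 + x + s \<le> (1 + x) * (1 + s)\<close>: the win rate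
  increases with age, so survival over a further time \<open>s\<close> is least likely for an old
  age.\<close>

lemma disc_surv_add_le:
  assumes "0 \<le> a" "0 \<le> x" "0 \<le> s"
  shows "disc_surv \<gamma> a (x + s) \<le> disc_surv \<gamma> a x * disc_surv \<gamma> a s"
proof -
  have "1 + (x + s) \<le> (1 + x) * (1 + s)"
    using assms by (simp add: algebra_simps)
  then have "(1 + (x + s)) powr a \<le> ((1 + x) * (1 + s)) powr a"
    using assms by (intro powr_mono2) auto
  then have "disc_surv \<gamma> a (x + s) \<le> exp (- (\<gamma> + a) * (x + s)) * ((1 + x) powr a * (1 + s) powr a)"
    unfolding disc_surv_def using assms by (intro mult_left_mono) (auto simp: powr_mult)
  also have "exp (- (\<gamma> + a) * (x + s)) = exp (- (\<gamma> + a) * x) * exp (- (\<gamma> + a) * s)"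
    by (simp add: exp_add[symmetric] algebra_simps)
  finally show ?thesis by (simp add: disc_surv_def mult_ac)
qed

text \<open>After a shift to the origin, submultiplicativity pulls out the factor
  \<open>disc_surv \<gamma> a x\<close>. This factor keeps the quotient of the tail by the survival
  function bounded uniformly in \<open>x\<close>.\<close>

lemma tail_integral_le:
  fixes g :: "real \<Rightarrow> real"
  assumes "0 \<le> \<gamma>" "0 < a" "0 \<le> x"
    and g [measurable]: "g \<in> borel_measurable borel" and B: "\<And>u. 0 \<le> u \<Longrightarrow> \<bar>g u\<bar> \<le> B"
  shows "\<bar>LBINT u:{x..}. g u * disc_surv \<gamma> a u\<bar> \<le> B * (LBINT u:{0..}. disc_surv \<gamma> a u) * disc_surv \<gamma> a x"
proof -
  have "0 \<le> B" using B[of 0] by simp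
  have "\<bar>LBINT u:{x..}. g u * disc_surv \<gamma> a u\<bar> = norm (LBINT s:{0..}. g (x + s) * disc_surv \<gamma> a (x + s))"
    by (simp add: set_integral_shift[of x])
  also have "\<dots> \<le> (LBINT s:{0..}. B * disc_surv \<gamma> a x * disc_surv \<gamma> a s)"
    unfolding set_lebesgue_integral_def
  proof (rule Bochner_Integration.integral_norm_bound_integral)
    have "set_integrable lborel {x..} (\<lambda>u. g u * disc_surv \<gamma> a u)"
      by (rule set_integrable_subset[OF set_integrable_mult_bounded[OF disc_surv_integrable]])
         (use assms in auto)
    then show "integrable lborel (\<lambda>s. indicator {0..} s *\<^sub>R (g (x + s) * disc_surv \<gamma> a (x + s)))"
      unfolding set_integrable_def
      by (subst (asm) lborel_integrable_real_affine_iff[of 1 _ x, symmetric]) (auto simp: indicator_def)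
    show "integrable lborel (\<lambda>s. indicator {0..} s *\<^sub>R (B * disc_surv \<gamma> a x * disc_surv \<gamma> a s))"
      using disc_surv_integrable[OF assms(1,2)] unfolding set_integrable_def[symmetric] by auto
    fix s :: real
    have "\<bar>g (x + s)\<bar> * disc_surv \<gamma> a (x + s) \<le> B * (disc_surv \<gamma> a x * disc_surv \<gamma> a s)" if "0 \<le> s"
      using that assms disc_surv_add_le[of a x s \<gamma>] disc_surv_pos[of "x + s" \<gamma> a] \<open>0 \<le> B\<close>
      by (intro mult_mono) auto
    then show "norm (indicator {0..} s *\<^sub>R (g (x + s) * disc_surv \<gamma> a (x + s)))
        \<le> indicator {0..} s *\<^sub>R (B * disc_surv \<gamma> a x * disc_surv \<gamma> a s)"
      using disc_surv_pos[of "x + s" \<gamma> a] assms by (auto simp: indicator_def abs_mult mult_ac)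
  qed
  finally show ?thesis by (simp add: mult_ac)
qed

text \<open>Minus the derivative of the survival function is integrated from \<open>0\<close>, where
  the function is 1, to infinity, where it vanishes. In probabilistic terms, the period ends either
  by discounting or by a win.\<close>

lemma disc_surv_integral_hazard:
  assumes "0 \<le> \<gamma>" "0 < a"
  shows "set_integrable lborel {0..} (\<lambda>u. value_at_age u * disc_surv \<gamma> a u)"
    and "\<gamma> * (LBINT u:{0..}. disc_surv \<gamma> a u) + a * (LBINT u:{0..}. value_at_age u * disc_surv \<gamma> a u) = 1"
proof -
  show i: "set_integrable lborel {0..} (\<lambda>u. value_at_age u * disc_surv \<gamma> a u)"
    by (rule set_integrable_mult_bounded[OF disc_surv_integrable, where B = 1])
       (use assms value_at_age_bounds in \<open>auto simp: abs_of_nonneg\<close>)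
  have "(LBINT u:{0..}. \<gamma> * disc_surv \<gamma> a u + a * (value_at_age u * disc_surv \<gamma> a u)) = - 0 - (- disc_surv \<gamma> a 0)"
  proof (rule set_integral_FTC_atLeast[where F = "\<lambda>u. - disc_surv \<gamma> a u"])
    show "((\<lambda>u. - disc_surv \<gamma> a u) has_real_derivative
        \<gamma> * disc_surv \<gamma> a u + a * (value_at_age u * disc_surv \<gamma> a u)) (at u within {0..})" if "0 \<le> u" for u
    proof -
      have "((\<lambda>u. - disc_surv \<gamma> a u) has_real_derivative
          - (- (\<gamma> + a * value_at_age u) * disc_surv \<gamma> a u)) (at u within {0..})"
        using that by (intro DERIV_minus disc_surv_deriv) simp
      then show ?thesis by (simp add: algebra_simps)
    qed
    show "set_integrable lborel {0..} (\<lambda>u. \<gamma> * disc_surv \<gamma> a u + a * (value_at_age u * disc_surv \<gamma> a u))"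
      by (intro set_integral_add(1) set_integrable_mult_right i disc_surv_integrable[OF assms])
    show "((\<lambda>u. - disc_surv \<gamma> a u) \<longlongrightarrow> - 0) at_top"
      by (rule tendsto_minus[OF disc_surv_tendsto[OF assms]])
  qed
  then show "\<gamma> * (LBINT u:{0..}. disc_surv \<gamma> a u) + a * (LBINT u:{0..}. value_at_age u * disc_surv \<gamma> a u) = 1"
    using i disc_surv_integrable[OF assms] by (subst (asm) set_integral_add) auto
qed

section \<open>Incomplete gamma integrals and the limit of vanishing discount\<close>

lemma upper_Gamma_eq:
  assumes "0 < a"
  shows "upper_Gamma (r + 1) a = a powr (r + 1) * exp (- a) * (LBINT x:{0..}. (1 + x) powr r * exp (- a * x))"
proof -
  \<comment> \<open>The substitution is \<open>t = a + a * x\<close>, which carries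
    \<open>{0..}\<close> onto \<open>{a..}\<close>.\<close>
  have "upper_Gamma (r + 1) a = \<bar>a\<bar> * (\<integral>x. indicator {a..} (a + a * x) *\<^sub>R ((a + a * x) powr r * exp (- (a + a * x))) \<partial>lborel)"
    unfolding upper_Gamma_def set_lebesgue_integral_def
    by (subst lborel_integral_real_affine[of a _ a]) (use assms in auto)
  also have "(\<lambda>x. indicator {a..} (a + a * x) *\<^sub>R ((a + a * x) powr r * exp (- (a + a * x)))) =
      (\<lambda>x. (a powr r * exp (- a)) * (indicator {0..} x *\<^sub>R ((1 + x) powr r * exp (- a * x))))"
  proof
    fix x
    have "(a + a * x) powr r = a powr r * (1 + x) powr r" if "0 \<le> x"
      using that assms by (simp add: powr_mult[symmetric] algebra_simps)
    moreover have "exp (- (a + a * x)) = exp (- a) * exp (- a * x)"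
      by (simp add: exp_add[symmetric])
    moreover have "a + a * x \<ge> a \<longleftrightarrow> 0 \<le> x"
      using assms by (simp add: zero_le_mult_iff)
    ultimately show "indicator {a..} (a + a * x) *\<^sub>R ((a + a * x) powr r * exp (- (a + a * x))) =
      (a powr r * exp (- a)) * (indicator {0..} x *\<^sub>R ((1 + x) powr r * exp (- a * x)))"
      by (auto simp: indicator_def)
  qed
  finally show ?thesis
    using assms by (simp add: set_lebesgue_integral_def powr_add)
qed

lemma disc_surv_0_integral:
  assumes "0 < a"
  shows "(LBINT u:{0..}. disc_surv 0 a u) = upper_Gamma (a + 1) a / (a powr (a + 1) * exp (- a))"
  using upper_Gamma_eq[OF assms, of a] assms by (simp add: disc_surv_def mult.commute)

text \<open>The product of \<open>value_at_age\<close> and \<open>disc_surv 0 a\<close> vanishes at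
  \<open>0\<close> and at infinity, so its derivative integrates to zero. This trades the reward for
  \<open>1 / (1 + u)\<^sup>2\<close>, which lowers the exponent of \<open>1 + u\<close> from
  \<open>a\<close> to \<open>a - 2\<close> and leaves a single gamma integral.\<close>

lemma disc_surv_0_integral_reward:
  assumes "0 < a"
  shows "set_integrable lborel {0..} (\<lambda>u. a * (value_at_age u)\<^sup>2 * disc_surv 0 a u)"
    and "(LBINT u:{0..}. a * (value_at_age u)\<^sup>2 * disc_surv 0 a u) =
      upper_Gamma (a - 1) a / (a powr (a - 1) * exp (- a))"
proof -
  have i1: "set_integrable lborel {0..} (\<lambda>u. a * (value_at_age u)\<^sup>2 * disc_surv 0 a u)"
    by (rule set_integrable_mult_bounded[OF disc_surv_integrable, where B = a])
       (use assms value_at_age_bounds in \<open>auto simp: abs_mult power_le_one\<close>)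
  have i2: "set_integrable lborel {0..} (\<lambda>u. 1 / (1 + u)\<^sup>2 * disc_surv 0 a u)"
    by (rule set_integrable_mult_bounded[OF disc_surv_integrable, where B = 1])
       (use assms in auto)
  have "(LBINT u:{0..}. a * (value_at_age u)\<^sup>2 * disc_surv 0 a u - 1 / (1 + u)\<^sup>2 * disc_surv 0 a u) =
      0 - (- value_at_age 0 * disc_surv 0 a 0)"
  proof (rule set_integral_FTC_atLeast[where F = "\<lambda>u. - value_at_age u * disc_surv 0 a u"])
    fix u :: real assume "0 \<le> u"
    then have "(value_at_age has_real_derivative 1 / (1 + u)\<^sup>2) (at u within {0..})"
      unfolding value_at_age_def[abs_def]
      by (auto intro!: derivative_eq_intros simp: power2_eq_square)
    then show "((\<lambda>u. - value_at_age u * disc_surv 0 a u) has_real_derivative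
        a * (value_at_age u)\<^sup>2 * disc_surv 0 a u - 1 / (1 + u)\<^sup>2 * disc_surv 0 a u) (at u within {0..})"
      using \<open>0 \<le> u\<close>
      by (auto intro!: derivative_eq_intros disc_surv_deriv simp: algebra_simps power2_eq_square)
  next
    show "set_integrable lborel {0..} (\<lambda>u. a * (value_at_age u)\<^sup>2 * disc_surv 0 a u - 1 / (1 + u)\<^sup>2 * disc_surv 0 a u)"
      by (rule set_integral_diff(1)[OF i1 i2])
    have "((\<lambda>u. - (1 - 1 / (1 + u))) \<longlongrightarrow> (-1::real)) at_top"
      by real_asymp
    from tendsto_mult[OF this disc_surv_tendsto[OF order_refl assms]]
    have "((\<lambda>u. - (1 - 1 / (1 + u)) * disc_surv 0 a u) \<longlongrightarrow> 0) at_top"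
      by simp
    then show "((\<lambda>u. - value_at_age u * disc_surv 0 a u) \<longlongrightarrow> 0) at_top"
      by (simp add: value_at_age_def)
  qed
  then have "(LBINT u:{0..}. a * (value_at_age u)\<^sup>2 * disc_surv 0 a u) = (LBINT u:{0..}. 1 / (1 + u)\<^sup>2 * disc_surv 0 a u)"
    using i1 i2 by (subst (asm) set_integral_diff) (auto simp: value_at_age_def)
  also have "\<dots> = (LBINT u:{0..}. (1 + u) powr (a - 2) * exp (- a * u))"
    by (intro set_lebesgue_integral_cong) (auto simp: disc_surv_def powr_diff)
  also have "\<dots> = upper_Gamma (a - 1) a / (a powr (a - 1) * exp (- a))"
    using upper_Gamma_eq[OF assms, of "a - 2"] assms by simp
  finally show "(LBINT u:{0..}. a * (value_at_age u)\<^sup>2 * disc_surv 0 a u) =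
      upper_Gamma (a - 1) a / (a powr (a - 1) * exp (- a))" .
  show "set_integrable lborel {0..} (\<lambda>u. a * (value_at_age u)\<^sup>2 * disc_surv 0 a u)" by fact
qed

text \<open>A nonnegative integrand with zero integral vanishes almost everywhere, but this one is
  positive on \<open>{0..1}\<close>, a set of positive measure.\<close>

lemma disc_surv_integral_pos:
  assumes "0 \<le> \<gamma>" "0 < a"
  shows "0 < (LBINT u:{0..}. disc_surv \<gamma> a u)"
proof -
  have "(LBINT u:{0..}. disc_surv \<gamma> a u) \<noteq> 0"
  proof
    assume "(LBINT u:{0..}. disc_surv \<gamma> a u) = 0"
    then have "AE u in lborel. indicator {0..} u *\<^sub>R disc_surv \<gamma> a u = 0"
      using disc_surv_integrable[OF assms] unfolding set_lebesgue_integral_def set_integrable_def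
      by (subst (asm) integral_nonneg_eq_0_iff_AE) (auto simp: disc_surv_def)
    then have "AE u in lborel. u \<notin> {0..1::real}"
    proof eventually_elim
      case (elim u)
      show ?case
      proof
        assume "u \<in> {0..1}"
        then show False using elim disc_surv_pos[of u \<gamma> a] by simp
      qed
    qed
    then have "emeasure lborel {0..1::real} = 0"
      by (subst (asm) AE_iff_measurable[of "{0..1}"]) auto
    then show False by simp
  qed
  moreover have "0 \<le> (LBINT u:{0..}. disc_surv \<gamma> a u)"
    unfolding set_lebesgue_integral_def by (rule integral_nonneg_AE) (auto simp: disc_surv_def)
  ultimately show ?thesis by simp
qed

text \<open>The discount enters only through the factor \<open>exp (- \<gamma> * u)\<close>, which
  is at most 1, so the integrand at \<open>\<gamma> = 0\<close> dominates.\<close>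

lemma disc_surv_discount_tendsto:
  fixes g :: "real \<Rightarrow> real"
  assumes g: "set_integrable lborel {0..} (\<lambda>u. g u * disc_surv 0 a u)"
  shows "((\<lambda>\<gamma>. LBINT u:{0..}. g u * disc_surv \<gamma> a u) \<longlongrightarrow> (LBINT u:{0..}. g u * disc_surv 0 a u)) (at_right 0)"
proof -
  have eq: "disc_surv \<gamma> a u = exp (- \<gamma> * u) * disc_surv 0 a u" for \<gamma> u
    by (simp add: disc_surv_def exp_add[symmetric] algebra_simps)
  \<comment> \<open>Writing \<open>\<gamma>\<close> as \<open>inverse t\<close> turns the right-hand
    limit at \<open>0\<close> into a limit at infinity, the form in which dominated convergence is
    applied.\<close>
  have "((\<lambda>t. LBINT u:{0..}. g u * disc_surv (inverse t) a u) \<longlongrightarrow> (LBINT u:{0..}. g u * disc_surv 0 a u)) at_top"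
    unfolding set_lebesgue_integral_def
  proof (rule integral_dominated_convergence_at_top)
    show "integrable lborel (\<lambda>u. norm (indicator {0..} u *\<^sub>R (g u * disc_surv 0 a u)))"
      using g unfolding set_integrable_def by (rule integrable_norm)
    show m: "(\<lambda>u. indicator {0..} u *\<^sub>R (g u * disc_surv 0 a u)) \<in> borel_measurable lborel"
      using g unfolding set_integrable_def by simp
    have e: "(\<lambda>u. indicator {0..} u *\<^sub>R (g u * disc_surv (inverse t) a u)) =
        (\<lambda>u. exp (- inverse t * u) * (indicator {0..} u *\<^sub>R (g u * disc_surv 0 a u)))" for t
      by (subst eq[of "inverse t"]) (auto simp: indicator_def)
    show "(\<lambda>u. indicator {0..} u *\<^sub>R (g u * disc_surv (inverse t) a u)) \<in> borel_measurable lborel" for t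
      unfolding e using m by (intro borel_measurable_times) auto
    show "\<forall>\<^sub>F t in at_top. AE u in lborel. norm (indicator {0..} u *\<^sub>R (g u * disc_surv (inverse t) a u))
        \<le> norm (indicator {0..} u *\<^sub>R (g u * disc_surv 0 a u))"
    proof (rule eventually_at_top_linorderI[of 1], intro AE_I2)
      fix t u :: real assume "1 \<le> t"
      then have "\<bar>disc_surv (inverse t) a u\<bar> \<le> 1 * \<bar>disc_surv 0 a u\<bar>" if "0 \<le> u"
        unfolding eq[of "inverse t"] abs_mult using that by (intro mult_right_mono) auto
      then show "norm (indicator {0..} u *\<^sub>R (g u * disc_surv (inverse t) a u))
        \<le> norm (indicator {0..} u *\<^sub>R (g u * disc_surv 0 a u))"
        by (auto simp: indicator_def abs_mult intro!: mult_left_mono)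
    qed
    show "AE u in lborel. ((\<lambda>t. indicator {0..} u *\<^sub>R (g u * disc_surv (inverse t) a u)) \<longlongrightarrow>
        indicator {0..} u *\<^sub>R (g u * disc_surv 0 a u)) at_top"
    proof (intro AE_I2)
      fix u :: real
      have "((\<lambda>t. exp (- inverse t * u)) \<longlongrightarrow> exp (- 0 * u)) at_top"
        by (intro tendsto_intros tendsto_inverse_0_at_top filterlim_ident)
      then have "((\<lambda>t. disc_surv (inverse t) a u) \<longlongrightarrow> disc_surv 0 a u) at_top"
        unfolding eq[of "inverse _"] using tendsto_mult_right[of _ 1 at_top "disc_surv 0 a u"] by simp
      then show "((\<lambda>t. indicator {0..} u *\<^sub>R (g u * disc_surv (inverse t) a u)) \<longlongrightarrow>
        indicator {0..} u *\<^sub>R (g u * disc_surv 0 a u)) at_top"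
        unfolding real_scaleR_def by (intro tendsto_mult tendsto_const)
    qed
  qed
  then show ?thesis by (simp only: filterlim_at_right_to_top)
qed

section \<open>The shading policy\<close>

text \<open>Two views of one value: \<open>h x\<close> is the value between auctions at age
  \<open>x\<close>, and \<open>f x\<close> is the value when an auction is just being held at that
  age. The restart value \<open>v\<close> occurs in the equation for \<open>h\<close>, and its
  formula is the one forced by consistency at age \<open>0\<close>. The last two properties together
  are the dynamic programming equation.\<close>

lemma bellman_solution:
  fixes \<mu> \<alpha> \<gamma> :: real
  defines "W \<equiv> disc_surv \<gamma> (\<mu> * \<alpha>)" and "g \<equiv> \<lambda>x. \<alpha> * (1 - \<alpha> / 2) * (value_at_age x)\<^sup>2"
  defines "v \<equiv> (1 - \<alpha> / 2) * (LBINT u:{0..}. \<mu> * \<alpha> * (value_at_age u)\<^sup>2 * W u) / (\<gamma> * (LBINT u:{0..}. W u))"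
  assumes "0 < \<mu>" "0 < \<alpha>" "\<alpha> \<le> 1" "0 < \<gamma>"
  obtains f h :: "real \<Rightarrow> real" and B where
    "f \<in> borel_measurable borel" "\<And>x. \<bar>f x\<bar> \<le> B" "h 0 = v"
    "\<And>x. 0 \<le> x \<Longrightarrow> f x = g x + \<alpha> * value_at_age x * v + (1 - \<alpha> * value_at_age x) * h x"
    "\<And>x. 0 \<le> x \<Longrightarrow> (LBINT s:{0..}. \<mu> * exp (- (\<mu> + \<gamma>) * s) * f (x + s)) = h x"
proof -
  note params = \<open>0 < \<mu>\<close> \<open>0 < \<alpha>\<close> \<open>\<alpha> \<le> 1\<close> \<open>0 < \<gamma>\<close>
  have a: "0 < \<mu> * \<alpha>" using params by simp
  define J where "J = (LBINT u:{0..}. W u)"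
  have J: "0 < J"
    unfolding J_def W_def using params by (intro disc_surv_integral_pos) auto
  have W_int: "set_integrable lborel {0..} W"
    unfolding W_def using params a by (intro disc_surv_integrable) auto
  have W_pos: "0 < W x" if "0 \<le> x" for x
    unfolding W_def using that by (intro disc_surv_pos) auto
  have k_le: "0 \<le> value_at_age x" "value_at_age x \<le> 1" "0 \<le> \<alpha> * value_at_age x" "\<alpha> * value_at_age x \<le> 1"
    if "0 \<le> x" for x
    using value_at_age_bounds[OF that] params by (auto intro: mult_le_one)
  have g_le: "\<bar>g x\<bar> \<le> 1" if "0 \<le> x" for x
  proof -
    have "\<alpha> * (1 - \<alpha> / 2) \<le> 1" using params by (intro mult_le_one) auto
    moreover have "0 \<le> \<alpha> * (1 - \<alpha> / 2)" using params by simp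
    moreover have "(value_at_age x)\<^sup>2 \<le> 1" using k_le[OF that] by (intro power_le_one)
    ultimately show ?thesis unfolding g_def by (simp add: abs_mult mult_le_one)
  qed
  have g_measurable [measurable]: "g \<in> borel_measurable borel"
    unfolding g_def by measurable
  \<comment> \<open>The source term of
    \<open>h' = (\<gamma> + \<mu> * \<alpha> * k) * h - \<phi>\<close>, with \<open>k\<close> for
    \<open>value_at_age\<close>: at rate \<open>\<mu>\<close> an auction yields its mean payoff and,
    with the probability of a win, the restart value \<open>v\<close>.\<close>
  define \<phi> where "\<phi> = (\<lambda>x. \<mu> * (g x + \<alpha> * value_at_age x * v))"
  have \<phi>_measurable [measurable]: "\<phi> \<in> borel_measurable borel"
    unfolding \<phi>_def by measurable
  have \<phi>_cont: "continuous_on {0..} \<phi>"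
    unfolding \<phi>_def g_def by (intro continuous_intros)
  define \<Phi> where "\<Phi> = \<mu> * (1 + \<bar>v\<bar>)"
  have gv_le: "\<bar>g x + \<alpha> * value_at_age x * v\<bar> \<le> 1 + \<bar>v\<bar>" if "0 \<le> x" for x
  proof -
    have "\<bar>\<alpha> * value_at_age x * v\<bar> \<le> 1 * \<bar>v\<bar>"
      unfolding abs_mult[of _ v] using k_le[OF that] by (intro mult_right_mono) auto
    then show ?thesis using g_le[OF that] by linarith
  qed
  have \<phi>_le: "\<bar>\<phi> x\<bar> \<le> \<Phi>" if "0 \<le> x" for x
    unfolding \<phi>_def \<Phi>_def abs_mult[of \<mu>] using gv_le[OF that] params by (intro mult_mono) auto
  have \<phi>W_int: "set_integrable lborel {0..} (\<lambda>u. \<phi> u * W u)"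
    by (rule set_integrable_mult_bounded[OF W_int \<phi>_measurable]) (use \<phi>_le in auto)
  have \<phi>W_cont: "continuous_on {0..} (\<lambda>u. \<phi> u * W u)"
    unfolding W_def by (intro continuous_intros \<phi>_cont)
  \<comment> \<open>Variation of constants, with \<open>1 / W\<close> solving the homogeneous
    equation. Integrating from \<open>x\<close> to infinity selects the bounded solution.\<close>
  define h where "h = (\<lambda>x. (LBINT u:{x..}. \<phi> u * W u) / W x)"
  have h_le: "\<bar>h x\<bar> \<le> \<Phi> * J" if "0 \<le> x" for x
  proof -
    have "\<bar>LBINT u:{x..}. \<phi> u * W u\<bar> \<le> \<Phi> * J * W x"
      unfolding J_def W_def using params a that \<phi>_le by (intro tail_integral_le) auto
    then show ?thesis
      unfolding h_def abs_divide using W_pos[OF that] by (simp add: pos_divide_le_eq)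
  qed
  have h_deriv: "(h has_real_derivative (\<gamma> + \<mu> * \<alpha> * value_at_age x) * h x - \<phi> x) (at x within {0..})"
    if "0 \<le> x" for x
  proof -
    have "(h has_real_derivative
        (- (\<phi> x * W x) * W x - (LBINT u:{x..}. \<phi> u * W u) * (- (\<gamma> + \<mu> * \<alpha> * value_at_age x) * W x)) / (W x * W x))
        (at x within {0..})"
      unfolding h_def
    proof (rule DERIV_divide)
      show "((\<lambda>x. LBINT u:{x..}. \<phi> u * W u) has_real_derivative - (\<phi> x * W x)) (at x within {0..})"
        by (rule has_real_derivative_tail_integral[OF \<phi>W_cont \<phi>W_int that])
      show "(W has_real_derivative - (\<gamma> + \<mu> * \<alpha> * value_at_age x) * W x) (at x within {0..})"
        unfolding W_def using that by (intro disc_surv_deriv) auto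
    qed (use W_pos[OF that] in simp)
    also have "(- (\<phi> x * W x) * W x - (LBINT u:{x..}. \<phi> u * W u) * (- (\<gamma> + \<mu> * \<alpha> * value_at_age x) * W x)) / (W x * W x)
        = (\<gamma> + \<mu> * \<alpha> * value_at_age x) * h x - \<phi> x"
      using W_pos[OF that] by (simp add: h_def field_simps)
    finally show ?thesis .
  qed
  have h_meas: "(\<lambda>x. indicator {0..} x *\<^sub>R h x) \<in> borel_measurable borel"
    by (rule borel_measurable_continuous_on_indicator) (auto intro: DERIV_continuous_on[OF h_deriv])
  \<comment> \<open>Measurability and the bound are needed on the whole line, so \<open>f\<close> is
    set to \<open>0\<close> at negative ages; \<open>h\<close> is controlled only on the half-line,
    where it is continuous.\<close>
  define f where "f = (\<lambda>x. indicator {0..} x * (g x + \<alpha> * value_at_age x * v) +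
    (1 - \<alpha> * value_at_age x) * (indicator {0..} x *\<^sub>R h x))"
  have f_eq: "f x = g x + \<alpha> * value_at_age x * v + (1 - \<alpha> * value_at_age x) * h x" if "0 \<le> x" for x
    using that by (simp add: f_def)
  have f_meas [measurable]: "f \<in> borel_measurable borel"
    unfolding f_def by (intro borel_measurable_add borel_measurable_times h_meas) measurable
  define B where "B = 1 + \<bar>v\<bar> + \<Phi> * J"
  have B_nonneg: "0 \<le> \<Phi> * J" using h_le[of 0] by simp
  have f_le: "\<bar>f x\<bar> \<le> B" for x
  proof (cases "0 \<le> x")
    case True
    have "\<bar>(1 - \<alpha> * value_at_age x) * h x\<bar> \<le> 1 * (\<Phi> * J)"
      unfolding abs_mult using k_le[OF True] h_le[OF True] by (intro mult_mono) auto
    then show ?thesis using gv_le[OF True] unfolding f_eq[OF True] B_def by linarith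
  next
    case False
    then show ?thesis using B_nonneg by (simp add: f_def B_def)
  qed
  \<comment> \<open>The source is affine in \<open>v\<close>. With
    \<open>\<mu> * \<alpha> * ?L = 1 - \<gamma> * J\<close>, the claim reduces to
    \<open>(1 - \<alpha> / 2) * ?K = v * \<gamma> * J\<close>, which is the definition of
    \<open>v\<close>.\<close>
  have h_0: "h 0 = v"
  proof -
    let ?K = "LBINT u:{0..}. \<mu> * \<alpha> * (value_at_age u)\<^sup>2 * W u"
    let ?L = "LBINT u:{0..}. value_at_age u * W u"
    note hazard = disc_surv_integral_hazard[OF less_imp_le[OF \<open>0 < \<gamma>\<close>] a, folded W_def, folded J_def]
    have i: "set_integrable lborel {0..} (\<lambda>u. \<mu> * \<alpha> * (value_at_age u)\<^sup>2 * W u)"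
      by (rule set_integrable_mult_bounded[OF W_int, where B = "\<mu> * \<alpha>"])
         (use params k_le in \<open>auto simp: abs_mult power_le_one\<close>)
    have "h 0 = (LBINT u:{0..}. \<phi> u * W u)"
      by (simp add: h_def W_def)
    also have "\<dots> = (LBINT u:{0..}. (1 - \<alpha> / 2) * (\<mu> * \<alpha> * (value_at_age u)\<^sup>2 * W u) + v * \<mu> * \<alpha> * (value_at_age u * W u))"
      by (intro arg_cong[where f = "set_lebesgue_integral lborel {0..}"] ext) (simp add: \<phi>_def g_def algebra_simps)
    also have "\<dots> = (1 - \<alpha> / 2) * ?K + v * \<mu> * \<alpha> * ?L"
      using i hazard(1) by (subst set_integral_add) auto
    also have "\<mu> * \<alpha> * ?L = 1 - \<gamma> * J"
      using hazard(2) by simp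
    then have "v * \<mu> * \<alpha> * ?L = v - v * \<gamma> * J"
      by (simp add: mult.assoc) (simp add: algebra_simps)
    also have "(1 - \<alpha> / 2) * ?K = v * \<gamma> * J"
      using J params by (simp add: v_def J_def)
    finally show ?thesis by simp
  qed
  have renewal: "(LBINT s:{0..}. \<mu> * exp (- (\<mu> + \<gamma>) * s) * f (x + s)) = h x" if x: "0 \<le> x" for x
  proof -
    \<comment> \<open>Rewritten with \<open>f\<close>, the differential equation is
      \<open>h' = (\<mu> + \<gamma>) * h - \<mu> * f\<close>, so \<open>?F\<close> is an
      antiderivative of the integrand; it tends to \<open>0\<close> because \<open>h\<close> is
      bounded.\<close>
    let ?F = "\<lambda>s. - exp (- (\<mu> + \<gamma>) * s) * h (x + s)"
    have "(LBINT s:{0..}. \<mu> * exp (- (\<mu> + \<gamma>) * s) * f (x + s)) = 0 - ?F 0"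
    proof (rule set_integral_FTC_atLeast[where F = ?F])
      fix s :: real assume s: "0 \<le> s"
      have "((\<lambda>s. h (x + s)) has_real_derivative ((\<gamma> + \<mu> * \<alpha> * value_at_age (x + s)) * h (x + s) - \<phi> (x + s)) * 1)
          (at s within {0..})"
      proof (rule DERIV_image_chain[of h _ "\<lambda>s. x + s", unfolded o_def])
        show "(h has_real_derivative (\<gamma> + \<mu> * \<alpha> * value_at_age (x + s)) * h (x + s) - \<phi> (x + s))
            (at (x + s) within (\<lambda>s. x + s) ` {0..})"
          by (rule DERIV_subset[OF h_deriv]) (use x s in auto)
        show "((\<lambda>s. x + s) has_real_derivative 1) (at s within {0..})"
          by (auto intro!: derivative_eq_intros)
      qed
      moreover have "((\<lambda>s. - exp (- (\<mu> + \<gamma>) * s)) has_real_derivative (\<mu> + \<gamma>) * exp (- (\<mu> + \<gamma>) * s)) (at s within {0..})"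
        by (auto intro!: derivative_eq_intros simp: algebra_simps)
      ultimately have "(?F has_real_derivative
          (\<mu> + \<gamma>) * exp (- (\<mu> + \<gamma>) * s) * h (x + s) +
          ((\<gamma> + \<mu> * \<alpha> * value_at_age (x + s)) * h (x + s) - \<phi> (x + s)) * 1 * - exp (- (\<mu> + \<gamma>) * s))
          (at s within {0..})"
        by (intro DERIV_mult)
      also have "(\<mu> + \<gamma>) * exp (- (\<mu> + \<gamma>) * s) * h (x + s) +
          ((\<gamma> + \<mu> * \<alpha> * value_at_age (x + s)) * h (x + s) - \<phi> (x + s)) * 1 * - exp (- (\<mu> + \<gamma>) * s) =
          \<mu> * exp (- (\<mu> + \<gamma>) * s) * f (x + s)"
        using x s by (simp add: f_eq \<phi>_def) algebra
      finally show "(?F has_real_derivative \<mu> * exp (- (\<mu> + \<gamma>) * s) * f (x + s)) (at s within {0..})" .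
    next
      have "set_integrable lborel {0..} (\<lambda>s. (\<mu> * f (x + s)) * exp (- (\<mu> + \<gamma>) * s))"
        by (rule set_integrable_mult_bounded[OF set_integrable_exp, where B = "\<mu> * B"])
           (use params f_le in \<open>auto simp: abs_mult\<close>)
      then show "set_integrable lborel {0..} (\<lambda>s. \<mu> * exp (- (\<mu> + \<gamma>) * s) * f (x + s))"
        by (simp only: mult_ac)
      show "(?F \<longlongrightarrow> 0) at_top"
      proof (rule Lim_null_comparison)
        show "\<forall>\<^sub>F s in at_top. norm (?F s) \<le> \<Phi> * J * exp (- (\<mu> + \<gamma>) * s)"
          using h_le x by (intro eventually_at_top_linorderI[of 0]) (simp add: abs_mult mult.commute mult_left_mono)
        show "((\<lambda>s. \<Phi> * J * exp (- (\<mu> + \<gamma>) * s)) \<longlongrightarrow> 0) at_top"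
          by (rule exp_decay_tendsto) (use params in simp)
      qed
    qed
    then show ?thesis by simp
  qed
  show thesis by (rule that[OF f_meas f_le h_0 f_eq renewal])
qed

section \<open>Uniform prices and linear shading\<close>

lemma (in auction_policy) next_value_set_integral:
  "next_value f x = (LBINT s:{0..}. \<mu> * exp (- (\<mu> + \<gamma>) * s) * f (x + s))"
  unfolding next_value_def set_lebesgue_integral_def
  by (intro Bochner_Integration.integral_cong refl)
     (auto simp: exponential_density_def indicator_def exp_add[symmetric] algebra_simps)

lemma uniform_second_price_payoff:
  fixes y p :: real
  assumes "0 \<le> p" "p \<le> 1"
  shows "(\<integral>c. (y - c) * of_bool (p > c) \<partial>uniform_measure lborel {0..1}) = y * p - p\<^sup>2 / 2"
proof -
  have density: "uniform_measure lborel {0..1::real} = density lborel (\<lambda>c. ennreal (indicator {0..1} c))"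
    by (simp add: uniform_measure_def ennreal_indicator divide_ennreal_def)
  have "(\<integral>c. (y - c) * of_bool (p > c) \<partial>uniform_measure lborel {0..1}) =
      (\<integral>c. indicator {0..1} c * ((y - c) * of_bool (p > c)) \<partial>lborel)"
    unfolding density by (subst integral_real_density) auto
  also have "\<dots> = (\<integral>c. (y - c) * indicator {0..p} c \<partial>lborel)"
  proof (rule integral_cong_AE)
    \<comment> \<open>The strict inequality of a win and the closed interval differ only at
      \<open>c = p\<close>.\<close>
    show "AE c in lborel. indicator {0..1} c * ((y - c) * of_bool (p > c)) = (y - c) * indicator {0..p} c"
      using AE_lborel_singleton[of p] by eventually_elim (use assms in \<open>auto simp: indicator_def\<close>)
  qed auto
  also have "\<dots> = (y * p - p\<^sup>2 / 2) - (y * 0 - 0\<^sup>2 / 2)"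
    by (rule integral_FTC_Icc_real)
       (use assms in \<open>auto intro!: derivative_eq_intros continuous_intros\<close>)
  finally show ?thesis by simp
qed

text \<open>For uniform prices a bid in \<open>{0..1}\<close> wins with probability equal to the
  bid, and the mean payoff is the source \<open>g\<close> of the solved equation. That solution
  therefore telescopes the payoffs, and the value from age \<open>0\<close> is \<open>h 0\<close>,
  the restart value.\<close>

lemma shading_policy_value:
  assumes model: "auction_model M \<mu> T (uniform_measure lborel {0..1}) C"
    and "0 < \<gamma>" "0 < \<alpha>" "\<alpha> \<le> 1"
  shows "\<gamma> * policy_value M T C value_at_age (\<lambda>\<tau>. \<alpha> * value_at_age \<tau>) \<gamma> 0 =
    (1 - \<alpha> / 2) * ((LBINT u:{0..}. \<mu> * \<alpha> * (value_at_age u)\<^sup>2 * disc_surv \<gamma> (\<mu> * \<alpha>) u) /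
      (LBINT u:{0..}. disc_surv \<gamma> (\<mu> * \<alpha>) u))"
proof -
  interpret auction_policy M \<mu> T "uniform_measure lborel {0..1}" C
      value_at_age "\<lambda>\<tau>. \<alpha> * value_at_age \<tau>" \<gamma> 0
    using assms by (intro auction_policy.intro auction_policy_axioms.intro model) auto
  have bid: "0 \<le> \<alpha> * value_at_age x" "\<alpha> * value_at_age x \<le> 1" if "0 \<le> x" for x
    using value_at_age_bounds[OF that] assms by (auto intro: mult_le_one)
  have win: "win_prob x = \<alpha> * value_at_age x" if "0 \<le> x" for x
  proof -
    have "{0..1} \<inter> {..<\<alpha> * value_at_age x} = {0..<\<alpha> * value_at_age x}"
      using bid[OF that] by auto
    then show ?thesis
      unfolding win_prob_def using bid[OF that] by (subst measure_uniform_measure) auto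
  qed
  have pay: "mean_payoff x = \<alpha> * (1 - \<alpha> / 2) * (value_at_age x)\<^sup>2" if "0 \<le> x" for x
    unfolding mean_payoff_def uniform_second_price_payoff[OF bid[OF that]]
    by (simp add: power2_eq_square algebra_simps)
  define v where "v = (1 - \<alpha> / 2) *
    (LBINT u:{0..}. \<mu> * \<alpha> * (value_at_age u)\<^sup>2 * disc_surv \<gamma> (\<mu> * \<alpha>) u) /
    (\<gamma> * (LBINT u:{0..}. disc_surv \<gamma> (\<mu> * \<alpha>) u))"
  obtain f h B where f: "f \<in> borel_measurable borel" "\<And>x. \<bar>f x\<bar> \<le> B"
    and h0: "h 0 = v"
    and f_eq: "\<And>x. 0 \<le> x \<Longrightarrow> f x = \<alpha> * (1 - \<alpha> / 2) * (value_at_age x)\<^sup>2 + \<alpha> * value_at_age x * v +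
      (1 - \<alpha> * value_at_age x) * h x"
    and renewal: "\<And>x. 0 \<le> x \<Longrightarrow> (LBINT s:{0..}. \<mu> * exp (- (\<mu> + \<gamma>) * s) * f (x + s)) = h x"
    by (rule bellman_solution[OF intensity_pos \<open>0 < \<alpha>\<close> \<open>\<alpha> \<le> 1\<close> \<open>0 < \<gamma>\<close>, folded v_def])
      (rule that; assumption)
  have "policy_value M T C value_at_age (\<lambda>\<tau>. \<alpha> * value_at_age \<tau>) \<gamma> 0 = next_value f 0"
  \<comment> \<open>\<open>L = 1\<close> suffices: on a win the price is below the shaded value, so
    the payoff lies between \<open>0\<close> and \<open>1\<close>.\<close>
  proof (rule policy_value_eq[OF f, where L = 1])
    show "\<bar>(value_at_age x - c) * of_bool (\<alpha> * value_at_age x > c)\<bar> \<le> 1" if "0 \<le> x" "0 \<le> c" for x c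
      using value_at_age_bounds[OF that(1)] bid[OF that(1)] that by auto
    show "f x = mean_payoff x + win_prob x * next_value f 0 + (1 - win_prob x) * next_value f x" if "0 \<le> x" for x
      by (simp only: next_value_set_integral renewal[OF that] renewal[OF order_refl] win[OF that] pay[OF that] f_eq[OF that] h0)
  qed
  also have "next_value f 0 = v"
    by (simp only: next_value_set_integral renewal[OF order_refl] h0)
  finally show ?thesis using \<open>0 < \<gamma>\<close> by (simp add: v_def)
qed

theorem theorem3:
  fixes M :: "'a measure" and T C :: "nat \<Rightarrow> 'a \<Rightarrow> real"
    and \<mu> \<alpha> :: real and k :: "real \<Rightarrow> real"
  assumes "auction_model M \<mu> T (uniform_measure lborel {0..1}) C"
    and "k = (\<lambda>t. 1 - 1 / (1 + t))"
    and "0 < \<mu>" and "0 < \<alpha>" and "\<alpha> \<le> 1" and "1 < \<mu> * \<alpha>"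
  shows "((\<lambda>\<gamma>. \<gamma> * policy_value M T C k (\<lambda>\<tau>. \<alpha> * k \<tau>) \<gamma> 0) \<longlongrightarrow>
           (1 - \<alpha> / 2) * (\<mu> * \<alpha>)\<^sup>2 *
             (upper_Gamma (\<mu> * \<alpha> - 1) (\<mu> * \<alpha>) / upper_Gamma (\<mu> * \<alpha> + 1) (\<mu> * \<alpha>)))
         (at_right 0)"
proof -
  define a where "a = \<mu> * \<alpha>"
  have a: "0 < a" using assms by (simp add: a_def)
  have k: "k = value_at_age"
    by (simp add: assms(2) value_at_age_def fun_eq_iff)
  let ?R = "\<lambda>\<gamma>. LBINT u:{0..}. a * (value_at_age u)\<^sup>2 * disc_surv \<gamma> a u"
  let ?J = "\<lambda>\<gamma>. LBINT u:{0..}. disc_surv \<gamma> a u"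
  have "(?R \<longlongrightarrow> ?R 0) (at_right 0)"
    by (rule disc_surv_discount_tendsto[OF disc_surv_0_integral_reward(1)[OF a]])
  moreover have "(?J \<longlongrightarrow> ?J 0) (at_right 0)"
    using disc_surv_discount_tendsto[of "\<lambda>_. 1" a] disc_surv_integrable[of 0 a] a by simp
  moreover have "?J 0 \<noteq> 0"
    using disc_surv_integral_pos[of 0 a] a by simp
  ultimately have lim: "((\<lambda>\<gamma>. (1 - \<alpha> / 2) * (?R \<gamma> / ?J \<gamma>)) \<longlongrightarrow> (1 - \<alpha> / 2) * (?R 0 / ?J 0)) (at_right 0)"
    by (intro tendsto_mult tendsto_divide tendsto_const)
  \<comment> \<open>The exponentials cancel, and the quotient of \<open>a powr (a + 1)\<close> by
    \<open>a powr (a - 1)\<close> leaves the factor \<open>a\<^sup>2\<close>.\<close>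
  have limit_eq: "?R 0 / ?J 0 = a\<^sup>2 * (upper_Gamma (a - 1) a / upper_Gamma (a + 1) a)"
    unfolding disc_surv_0_integral_reward(2)[OF a] disc_surv_0_integral[OF a]
    using a by (simp add: powr_add powr_diff power2_eq_square)
  have ev: "\<forall>\<^sub>F \<gamma> in at_right 0. (1 - \<alpha> / 2) * (?R \<gamma> / ?J \<gamma>) =
      \<gamma> * policy_value M T C k (\<lambda>\<tau>. \<alpha> * k \<tau>) \<gamma> 0"
    using eventually_at_right_less[of 0]
    by eventually_elim (use shading_policy_value[OF assms(1)] assms(4,5) in \<open>simp add: k a_def\<close>)
  show ?thesis
    using Lim_transform_eventually[OF lim ev] unfolding limit_eq by (simp only: a_def mult.assoc)
qed

end
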